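(* Let $(\mathfrak g,[\cdot,\cdot],\omega)$ be a solvable symplectic Lie algebra possessing a nonzero isotropic ideal. Then $(\mathfrak g,[\cdot,\cdot],\omega)$ is a symplectic double extension by a line or by a plane of a solvable symplectic Lie algebra $(\mathfrak a,[\cdot,\cdot]_{\mathfrak a},\omega_{\mathfrak a})$.
   Context: All Lie algebras are real and finite-dimensional. A symplectic Lie algebra $(\mathfrak g,[\cdot,\cdot],\omega)$ is a Lie algebra with a nondegenerate skew-symmetric bilinear form $\omega$ satisfying $\omega([x,y],z)+\omega([y,z],x)+\omega([z,x],y)=0$ for all $x,y,z$. For a subspace $\mathfrak m$, $\mathfrak m^\perp=\{x:\omega(x,y)=0\ \forall y\in\mathfrak m\}$; $\mathfrak m$ is isotropic if $\mathfrak m\subset\mathfrak m^\perp$. The zero Lie algebra is allowed as a (solvable) symplectic Lie algebra. Isomorphisms of symplectic Lie algebras are Lie algebra isomorphisms preserving the symplectic forms. In the two constructions that follow, brackets that are not listed are zero or given by skew-symmetry, and $x,y$ range over $\mathfrak a$. Double extension by a line. Let $(\mathfrak a,[\cdot,\cdot]_{\mathfrak a},\omega_{\mathfrak a})$ be a symplectic Lie algebra, $p,q\in\mathfrak a$, $D\in\mathfrak{gl}(\mathfrak a)$, $\varepsilon\in\mathbb R$. On $\mathfrak g=\mathbb R d_0\oplus\mathfrak a\oplus\mathbb R e_0$ put $[e_0,d_0]=\varepsilon e_0$, $[d_0,x]=\omega_{\mathfrak a}(p,x)d_0+D(x)+\omega_{\mathfrak a}(q,x)e_0$, $[x,e_0]=\omega_{\mathfrak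 a}(p,x)e_0$, $[x,y]=[x,y]_{\mathfrak a}+\big(\omega_{\mathfrak a}(D(x),y)+\omega_{\mathfrak a}(x,D(y))\big)e_0$, and let $\omega$ extend $\omega_{\mathfrak a}$ with $\omega(d_0,e_0)=1$ and $\mathfrak a\perp\mathrm{span}\{d_0,e_0\}$. When $(p,q,D,\varepsilon)$ is such that $(\mathfrak g,[\cdot,\cdot],\omega)$ is a symplectic Lie algebra, it is called a symplectic double extension of $(\mathfrak a,[\cdot,\cdot]_{\mathfrak a},\omega_{\mathfrak a})$ by a line. Double extension by a plane. Let $(\mathfrak a,[\cdot,\cdot]_{\mathfrak a},\omega_{\mathfrak a})$ be a symplectic Lie algebra, $a_0,a_1,b_0,b_1,b_2,z\in\mathfrak a$, $D_0,D_1\in\mathfrak{gl}(\mathfrak a)$, $\varepsilon_0,\dots,\varepsilon_5\in\mathbb R$. On $\mathfrak g=\mathbb R d_0\oplus\mathbb R d_1\oplus\mathfrak a\oplus\mathbb R e_0\oplus\mathbb R e_1$ put $[d_0,e_0]=\varepsilon_0e_0+\varepsilon_1e_1$, $[d_0,e_1]=-\varepsilon_1e_0+\varepsilon_0e_1$, $[d_1,e_0]=\varepsilon_2e_0+\varepsilon_3e_1$, $[d_1,e_1]=-\varepsilon_3e_0+\varepsilon_2e_1$, $[d_0,d_1]=(\varepsilon_2-\varepsilon_1)d_0-(\varepsilon_0+\varepsilon_3)d_1+z+\varepsilon_4e_0+\varepsilon_5e_1$, $[d_0,x]=\omega_{\mathfrak a}(a_0,x)d_0+\omega_{\mathfrak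 a}(a_1,x)d_1+D_0(x)+\omega_{\mathfrak a}(b_0,x)e_0+\omega_{\mathfrak a}(b_1,x)e_1$, $[d_1,x]=-\omega_{\mathfrak a}(a_1,x)d_0+\omega_{\mathfrak a}(a_0,x)d_1+D_1(x)+\omega_{\mathfrak a}(b_1+z,x)e_0+\omega_{\mathfrak a}(b_2,x)e_1$, $[e_0,x]=-\omega_{\mathfrak a}(a_0,x)e_0+\omega_{\mathfrak a}(a_1,x)e_1$, $[e_1,x]=-\omega_{\mathfrak a}(a_1,x)e_0-\omega_{\mathfrak a}(a_0,x)e_1$, $[x,y]=[x,y]_{\mathfrak a}+\sum_{k=0}^1\big(\omega_{\mathfrak a}(D_k(x),y)+\omega_{\mathfrak a}(x,D_k(y))\big)e_k$, and $\omega=\omega_{\mathfrak a}+d_0^*\wedge e_0^*+d_1^*\wedge e_1^*$. When the data are such that $(\mathfrak g,[\cdot,\cdot],\omega)$ is a symplectic Lie algebra, it is called a symplectic double extension of $(\mathfrak a,[\cdot,\cdot]_{\mathfrak a},\omega_{\mathfrak a})$ by a plane. "Is a symplectic double extension by a line (respectively, by a plane) of $(\mathfrak a,[\cdot,\cdot]_{\mathfrak a},\omega_{\mathfrak a})$" means: is isomorphic, as a symplectic Lie algebra, to a symplectic Lie algebra $\mathbb R d_0\oplus\mathfrak a\oplus\mathbb R e_0$ built from some data $(p,q,D,\varepsilon)$ by the line construction (respectively, to a symplectic Lie algebra $\mathbb R d_0\oplus\mathbb R d_1\oplus\mathfrak a\oplus\mathbb R e_0\oplus\mathbb R e_1$ built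 from some data $(a_0,a_1,b_0,b_1,b_2,z,D_0,D_1,\varepsilon_0,\dots,\varepsilon_5)$ by the plane construction). *)

theory Defs
  imports "HOL-Analysis.Analysis"
begin

text \<open>
  A finite-dimensional real Lie algebra is given by a finite-dimensional subspace \<open>L\<close> of
  an arbitrary real vector space and a bracket that matters only on \<open>L\<close>. Working with carriers
  rather than with whole types makes the zero Lie algebra available.
\<close>

definition linear_between ::
    "'a::real_vector set \<Rightarrow> 'b::real_vector set \<Rightarrow> ('a \<Rightarrow> 'b) \<Rightarrow> bool" where
  "linear_between L M f \<longleftrightarrow>
     (\<forall>x\<in>L. f x \<in> M) \<and>
     (\<forall>x\<in>L. \<forall>y\<in>L. f (x + y) = f x + f y) \<and>
     (\<forall>c. \<forall>x\<in>L. f (c *\<^sub>R x) = c *\<^sub>R f x)"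

definition bilinear_between ::
    "'a::real_vector set \<Rightarrow> 'b::real_vector set \<Rightarrow> ('a \<Rightarrow> 'a \<Rightarrow> 'b) \<Rightarrow> bool" where
  "bilinear_between L M f \<longleftrightarrow>
     (\<forall>x\<in>L. linear_between L M (\<lambda>y. f x y)) \<and>
     (\<forall>y\<in>L. linear_between L M (\<lambda>x. f x y))"

locale lie_algebra_on =
  fixes L :: "'a::real_vector set" and br :: "'a \<Rightarrow> 'a \<Rightarrow> 'a"
  assumes subspace_carrier: "subspace L"
    and finite_dim_carrier: "\<exists>B. finite B \<and> span B = L"
    and bilinear_bracket: "bilinear_between L L br"
    and bracket_self: "x \<in> L \<Longrightarrow> br x x = 0"
    and jacobi: "x \<in> L \<Longrightarrow> y \<in> L \<Longrightarrow> z \<in> L \<Longrightarrow>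
      br x (br y z) + br y (br z x) + br z (br x y) = 0"

locale symplectic_lie_algebra_on = lie_algebra_on L br
  for L :: "'a::real_vector set" and br :: "'a \<Rightarrow> 'a \<Rightarrow> 'a" +
  fixes \<omega> :: "'a \<Rightarrow> 'a \<Rightarrow> real"
  assumes bilinear_form: "bilinear_between L UNIV \<omega>"
    and skew_form: "x \<in> L \<Longrightarrow> y \<in> L \<Longrightarrow> \<omega> x y = - \<omega> y x"
    and nondegenerate_form: "x \<in> L \<Longrightarrow> (\<And>y. y \<in> L \<Longrightarrow> \<omega> x y = 0) \<Longrightarrow> x = 0"
    and closed_form: "x \<in> L \<Longrightarrow> y \<in> L \<Longrightarrow> z \<in> L \<Longrightarrow>
      \<omega> (br x y) z + \<omega> (br y z) x + \<omega> (br z x) y = 0"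

definition derived_algebra :: "('a::real_vector \<Rightarrow> 'a \<Rightarrow> 'a) \<Rightarrow> 'a set \<Rightarrow> 'a set" where
  "derived_algebra br S = span {br x y | x y. x \<in> S \<and> y \<in> S}"

definition solvable_lie :: "'a::real_vector set \<Rightarrow> ('a \<Rightarrow> 'a \<Rightarrow> 'a) \<Rightarrow> bool" where
  "solvable_lie L br \<longleftrightarrow> (\<exists>n. (derived_algebra br ^^ n) L = {0})"

definition lie_ideal :: "'a::real_vector set \<Rightarrow> ('a \<Rightarrow> 'a \<Rightarrow> 'a) \<Rightarrow> 'a set \<Rightarrow> bool" where
  "lie_ideal L br I \<longleftrightarrow> subspace I \<and> I \<subseteq> L \<and> (\<forall>x\<in>L. \<forall>y\<in>I. br x y \<in> I)"

definition symp_perp :: "'a set \<Rightarrow> ('a \<Rightarrow> 'a \<Rightarrow> real) \<Rightarrow> 'a set \<Rightarrow> 'a set" where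
  "symp_perp L \<omega> M = {x \<in> L. \<forall>y\<in>M. \<omega> x y = 0}"

definition isotropic :: "'a set \<Rightarrow> ('a \<Rightarrow> 'a \<Rightarrow> real) \<Rightarrow> 'a set \<Rightarrow> bool" where
  "isotropic L \<omega> M \<longleftrightarrow> M \<subseteq> symp_perp L \<omega> M"

definition symplectic_lie_isomorphic ::
    "'a::real_vector set \<Rightarrow> ('a \<Rightarrow> 'a \<Rightarrow> 'a) \<Rightarrow> ('a \<Rightarrow> 'a \<Rightarrow> real) \<Rightarrow>
     'b::real_vector set \<Rightarrow> ('b \<Rightarrow> 'b \<Rightarrow> 'b) \<Rightarrow> ('b \<Rightarrow> 'b \<Rightarrow> real) \<Rightarrow> bool" where
  "symplectic_lie_isomorphic L br \<omega> L' br' \<omega>' \<longleftrightarrow>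
     (\<exists>f. linear_between L L' f \<and> bij_betw f L L' \<and>
        (\<forall>x\<in>L. \<forall>y\<in>L. f (br x y) = br' (f x) (f y)) \<and>
        (\<forall>x\<in>L. \<forall>y\<in>L. \<omega>' (f x) (f y) = \<omega> x y))"


section \<open>Double extension by a line\<close>

text \<open>
  The triple \<open>(s, x, t)\<close> stands for \<open>s d\<^sub>0 + x + t e\<^sub>0\<close>.
\<close>

definition line_carrier :: "'a::real_vector set \<Rightarrow> (real \<times> 'a \<times> real) set" where
  "line_carrier A = UNIV \<times> A \<times> UNIV"

text \<open>
  The five summands below are the contributions of \<open>[e\<^sub>0, d\<^sub>0]\<close>, \<open>[d\<^sub>0, x]\<close>, \<open>[x, e\<^sub>0]\<close>
  (each together with its skew-symmetric counterpart) and of the two parts of \<open>[x, y]\<close>.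
\<close>

definition line_bracket ::
    "('a::real_vector \<Rightarrow> 'a \<Rightarrow> 'a) \<Rightarrow> ('a \<Rightarrow> 'a \<Rightarrow> real) \<Rightarrow>
     'a \<Rightarrow> 'a \<Rightarrow> ('a \<Rightarrow> 'a) \<Rightarrow> real \<Rightarrow>
     real \<times> 'a \<times> real \<Rightarrow> real \<times> 'a \<times> real \<Rightarrow> real \<times> 'a \<times> real" where
  "line_bracket br \<omega> p q D \<epsilon> = (\<lambda>(s, x, t) (s', x', t').
     (let d0_x = (\<lambda>x. (\<omega> p x, D x, \<omega> q x));
          x_e0 = (\<lambda>x. (0, 0, \<omega> p x))
      in (t * s' - s * t') *\<^sub>R (0, 0, \<epsilon>)
       + (s *\<^sub>R d0_x x' - s' *\<^sub>R d0_x x)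
       + (t' *\<^sub>R x_e0 x - t *\<^sub>R x_e0 x')
       + (0, br x x', 0)
       + (0, 0, \<omega> (D x) x' + \<omega> x (D x'))))"

definition line_form ::
    "('a \<Rightarrow> 'a \<Rightarrow> real) \<Rightarrow> real \<times> 'a \<times> real \<Rightarrow> real \<times> 'a \<times> real \<Rightarrow> real" where
  "line_form \<omega> = (\<lambda>(s, x, t) (s', x', t'). \<omega> x x' + (s * t' - t * s'))"

definition double_extension_by_line ::
    "'g::real_vector set \<Rightarrow> ('g \<Rightarrow> 'g \<Rightarrow> 'g) \<Rightarrow> ('g \<Rightarrow> 'g \<Rightarrow> real) \<Rightarrow>
     'a::real_vector set \<Rightarrow> ('a \<Rightarrow> 'a \<Rightarrow> 'a) \<Rightarrow> ('a \<Rightarrow> 'a \<Rightarrow> real) \<Rightarrow> bool" where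
  "double_extension_by_line L br \<omega> A br\<^sub>A \<omega>\<^sub>A \<longleftrightarrow>
     symplectic_lie_algebra_on A br\<^sub>A \<omega>\<^sub>A \<and>
     (\<exists>p\<in>A. \<exists>q\<in>A. \<exists>D \<epsilon>.
        linear_between A A D \<and>
        symplectic_lie_algebra_on (line_carrier A)
          (line_bracket br\<^sub>A \<omega>\<^sub>A p q D \<epsilon>) (line_form \<omega>\<^sub>A) \<and>
        symplectic_lie_isomorphic L br \<omega>
          (line_carrier A) (line_bracket br\<^sub>A \<omega>\<^sub>A p q D \<epsilon>) (line_form \<omega>\<^sub>A))"


section \<open>Double extension by a plane\<close>

text \<open>
  The tuple \<open>(s0, s1, x, t0, t1)\<close> stands for \<open>s0 d\<^sub>0 + s1 d\<^sub>1 + x + t0 e\<^sub>0 + t1 e\<^sub>1\<close>.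
\<close>

type_synonym 'a plane_ext = "real \<times> real \<times> 'a \<times> real \<times> real"

definition plane_carrier :: "'a::real_vector set \<Rightarrow> 'a plane_ext set" where
  "plane_carrier A = UNIV \<times> UNIV \<times> A \<times> UNIV \<times> UNIV"

definition plane_bracket ::
    "('a::real_vector \<Rightarrow> 'a \<Rightarrow> 'a) \<Rightarrow> ('a \<Rightarrow> 'a \<Rightarrow> real) \<Rightarrow>
     'a \<Rightarrow> 'a \<Rightarrow> 'a \<Rightarrow> 'a \<Rightarrow> 'a \<Rightarrow> 'a \<Rightarrow> ('a \<Rightarrow> 'a) \<Rightarrow> ('a \<Rightarrow> 'a) \<Rightarrow>
     real \<Rightarrow> real \<Rightarrow> real \<Rightarrow> real \<Rightarrow> real \<Rightarrow> real \<Rightarrow>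
     'a plane_ext \<Rightarrow> 'a plane_ext \<Rightarrow> 'a plane_ext" where
  "plane_bracket br \<omega> a0 a1 b0 b1 b2 z D0 D1 \<epsilon>0 \<epsilon>1 \<epsilon>2 \<epsilon>3 \<epsilon>4 \<epsilon>5 =
     (\<lambda>(s0, s1, x, t0, t1) (s0', s1', x', t0', t1').
     (let d0_e0 = (0, 0, 0, \<epsilon>0, \<epsilon>1);
          d0_e1 = (0, 0, 0, - \<epsilon>1, \<epsilon>0);
          d1_e0 = (0, 0, 0, \<epsilon>2, \<epsilon>3);
          d1_e1 = (0, 0, 0, - \<epsilon>3, \<epsilon>2);
          d0_d1 = (\<epsilon>2 - \<epsilon>1, - (\<epsilon>0 + \<epsilon>3), z, \<epsilon>4, \<epsilon>5);
          d0_x = (\<lambda>x. (\<omega> a0 x, \<omega> a1 x, D0 x, \<omega> b0 x, \<omega> b1 x));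
          d1_x = (\<lambda>x. (- \<omega> a1 x, \<omega> a0 x, D1 x, \<omega> (b1 + z) x, \<omega> b2 x));
          e0_x = (\<lambda>x. (0, 0, 0, - \<omega> a0 x, \<omega> a1 x));
          e1_x = (\<lambda>x. (0, 0, 0, - \<omega> a1 x, - \<omega> a0 x))
      in (s0 * t0' - t0 * s0') *\<^sub>R d0_e0
       + (s0 * t1' - t1 * s0') *\<^sub>R d0_e1
       + (s1 * t0' - t0 * s1') *\<^sub>R d1_e0
       + (s1 * t1' - t1 * s1') *\<^sub>R d1_e1
       + (s0 * s1' - s1 * s0') *\<^sub>R d0_d1
       + (s0 *\<^sub>R d0_x x' - s0' *\<^sub>R d0_x x)
       + (s1 *\<^sub>R d1_x x' - s1' *\<^sub>R d1_x x)
       + (t0 *\<^sub>R e0_x x' - t0' *\<^sub>R e0_x x)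
       + (t1 *\<^sub>R e1_x x' - t1' *\<^sub>R e1_x x)
       + (0, 0, br x x', 0, 0)
       + (0, 0, 0, \<omega> (D0 x) x' + \<omega> x (D0 x'), \<omega> (D1 x) x' + \<omega> x (D1 x'))))"

definition plane_form ::
    "('a \<Rightarrow> 'a \<Rightarrow> real) \<Rightarrow> 'a plane_ext \<Rightarrow> 'a plane_ext \<Rightarrow> real" where
  "plane_form \<omega> = (\<lambda>(s0, s1, x, t0, t1) (s0', s1', x', t0', t1').
     \<omega> x x' + (s0 * t0' - t0 * s0') + (s1 * t1' - t1 * s1'))"

definition double_extension_by_plane ::
    "'g::real_vector set \<Rightarrow> ('g \<Rightarrow> 'g \<Rightarrow> 'g) \<Rightarrow> ('g \<Rightarrow> 'g \<Rightarrow> real) \<Rightarrow>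
     'a::real_vector set \<Rightarrow> ('a \<Rightarrow> 'a \<Rightarrow> 'a) \<Rightarrow> ('a \<Rightarrow> 'a \<Rightarrow> real) \<Rightarrow> bool" where
  "double_extension_by_plane L br \<omega> A br\<^sub>A \<omega>\<^sub>A \<longleftrightarrow>
     symplectic_lie_algebra_on A br\<^sub>A \<omega>\<^sub>A \<and>
     (\<exists>a0\<in>A. \<exists>a1\<in>A. \<exists>b0\<in>A. \<exists>b1\<in>A. \<exists>b2\<in>A. \<exists>z\<in>A. \<exists>D0 D1 \<epsilon>0 \<epsilon>1 \<epsilon>2 \<epsilon>3 \<epsilon>4 \<epsilon>5.
        linear_between A A D0 \<and> linear_between A A D1 \<and>
        symplectic_lie_algebra_on (plane_carrier A)
          (plane_bracket br\<^sub>A \<omega>\<^sub>A a0 a1 b0 b1 b2 z D0 D1 \<epsilon>0 \<epsilon>1 \<epsilon>2 \<epsilon>3 \<epsilon>4 \<epsilon>5)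
          (plane_form \<omega>\<^sub>A) \<and>
        symplectic_lie_isomorphic L br \<omega>
          (plane_carrier A)
          (plane_bracket br\<^sub>A \<omega>\<^sub>A a0 a1 b0 b1 b2 z D0 D1 \<epsilon>0 \<epsilon>1 \<epsilon>2 \<epsilon>3 \<epsilon>4 \<epsilon>5)
          (plane_form \<omega>\<^sub>A))"

end

theory Submission
  imports Defs "HOL-Computational_Algebra.Fundamental_Theorem_Algebra"
begin

text \<open>
  The argument has two independent halves.

  The representation-theoretic half is a real form of Lie's theorem: every nonzero ideal \<open>I\<close> of a
  solvable Lie algebra contains a nonzero vector \<open>e\<close> with \<open>[x, e] \<in> \<real> e\<close> for all \<open>x\<close>, or two
  independent vectors on whose span every \<open>x\<close> acts as multiplication by a complex number
  (\<open>ideal_contains_line_or_complex_plane\<close>). Take a minimal nonzero ideal \<open>V \<subseteq> I\<close>; it is an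
  irreducible module. The derived algebra acts on \<open>V\<close> by zero: the point is that \<open>[X, T]\<close> is never
  injective when it commutes with \<open>T\<close> (\<open>commutator_singular\<close>), so that no term of the derived
  series after \<open>L\<close> itself can be the last one with nonzero action. The algebra then acts by commuting
  operators, and Schur's argument together with the factorisation of real polynomials into factors
  of degree at most two makes each of them a real multiple of the identity, or all of them real
  combinations of the identity and one fixed operator of square \<open>-1\<close>.

  The symplectic half shows that the bracket formulas of a double extension are forced. Let \<open>J\<close> be
  the span of the one or two vectors just found; it is isotropic. Choose vectors \<open>d\<close> dual to them and
  let \<open>A\<close> be the orthogonal complement of \<open>J\<close> and the \<open>d\<close>'s. Then \<open>A\<close> is a copy of \<open>J\<^sup>\<bottom> / J\<close>, and the
  projection of the bracket to \<open>A\<close> makes it a solvable symplectic Lie algebra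
  (\<open>symplectic_reduction\<close>). Every linear functional on \<open>A\<close> is \<open>\<omega>(p, \<cdot>)\<close> for some \<open>p \<in> A\<close>
  (\<open>represent_functional\<close>), which supplies the vectors in the data of the extension; every
  coefficient of the bracket that is not free is computed from closedness of \<open>\<omega>\<close>
  (\<open>line_extension\<close>, \<open>plane_extension\<close>).

  Bracket and form are only meaningful on the carrier \<open>L\<close>. Composing them with a linear projection
  onto \<open>L\<close> gives operations that are bilinear and satisfy the Lie and closedness identities on the
  whole type, so that these identities apply without membership conditions.
\<close>

section \<open>Finite-dimensional subspaces and nondegenerate forms\<close>

definition finitely_spanned :: "'a::real_vector set \<Rightarrow> bool" where
  "finitely_spanned V \<longleftrightarrow> (\<exists>B. finite B \<and> V \<subseteq> span B)"

lemma finitely_spanned_mono: "finitely_spanned V \<Longrightarrow> W \<subseteq> V \<Longrightarrow> finitely_spanned W"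
  unfolding finitely_spanned_def by blast

lemma finitely_spanned_basis:
  assumes "subspace V" and "finitely_spanned V"
  obtains C where "independent C" "finite C" "span C = V" "card C = dim V"
proof -
  obtain B where B: "finite B" "V \<subseteq> span B"
    using assms(2) unfolding finitely_spanned_def by blast
  obtain C where C: "C \<subseteq> V" "independent C" "V \<subseteq> span C"
    using real_vector.maximal_independent_subset[of V] by blast
  have "finite C"
    using real_vector.independent_span_bound[of B C] B C by blast
  moreover have "span C = V"
    using C(1,3) assms(1) by (simp add: span_minimal subset_antisym)
  moreover have "card C = dim V"
    using real_vector.dim_unique[OF C(1,3,2) refl] by simp
  ultimately show thesis using that C(2) by blast
qed

lemma subspace_eq_if_dim_le:
  assumes "subspace U" "subspace W" "finitely_spanned W" "U \<subseteq> W" "dim W \<le> dim U"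
  shows "U = W"
proof (rule ccontr)
  assume "U \<noteq> W"
  then obtain w where w: "w \<in> W" "w \<notin> U" using assms(4) by blast
  obtain C where C: "independent C" "finite C" "span C = U" "card C = dim U"
    using finitely_spanned_basis[OF assms(1) finitely_spanned_mono[OF assms(3,4)]] by blast
  obtain B where B: "independent B" "finite B" "span B = W" "card B = dim W"
    using finitely_spanned_basis[OF assms(2,3)] by blast
  have "independent (insert w C)"
    using w(2) C(1,3) by (simp add: real_vector.independent_insertI)
  moreover have "insert w C \<subseteq> span B"
    using w(1) C(3) B(3) assms(4) span_superset[of C] by blast
  ultimately have "card (insert w C) \<le> card B"
    using real_vector.independent_span_bound[OF B(2)] by blast
  moreover have "w \<notin> C" using w(2) C(3) span_superset[of C] by blast
  ultimately show False using C(2,4) B(4) assms(5) by simp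
qed

text \<open>
  Least dimension forces minimality under inclusion. The predicate \<open>P\<close> will be stability under some
  family of operators.
\<close>

lemma minimal_nonzero_subspace:
  assumes "P V" "subspace V" "finitely_spanned V" "V \<noteq> {0}"
  obtains U where "P U" "subspace U" "U \<subseteq> V" "U \<noteq> {0}"
    and "\<And>W. P W \<Longrightarrow> subspace W \<Longrightarrow> W \<subseteq> U \<Longrightarrow> W \<noteq> {0} \<Longrightarrow> W = U"
proof -
  let ?Q = "\<lambda>U. P U \<and> subspace U \<and> U \<subseteq> V \<and> U \<noteq> {0}"
  have "\<exists>U. ?Q U \<and> (\<forall>W. ?Q W \<longrightarrow> dim U \<le> dim W)"
    by (rule ex_has_least_nat[of ?Q V dim]) (use assms in simp)
  then obtain U where U: "?Q U \<and> (\<forall>W. ?Q W \<longrightarrow> dim U \<le> dim W)" by (elim exE)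
  have "W = U" if W: "P W" "subspace W" "W \<subseteq> U" "W \<noteq> {0}" for W
  proof (rule subspace_eq_if_dim_le)
    have "?Q W" using W U by auto
    then show "dim W \<ge> dim U" using U by simp
    show "finitely_spanned U" by (rule finitely_spanned_mono[OF assms(3)]) (use U in simp)
  qed (use W U in simp_all)
  then show thesis using that[of U] U by simp
qed

text \<open>
  For a basis \<open>C\<close> of \<open>A\<close>, the map \<open>v \<mapsto> \<Sum>b\<in>C. \<omega> v b *\<^sub>R b\<close> records the values of \<open>\<omega> v\<close> on \<open>C\<close>. It is
  an injective endomorphism of \<open>A\<close> by nondegeneracy, hence surjective, so the values on \<open>C\<close> can be
  prescribed.
\<close>

lemma represent_functional:
  fixes \<omega> :: "'a::real_vector \<Rightarrow> 'a \<Rightarrow> real"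
  assumes bil: "bilinear \<omega>" and A: "subspace A" "finitely_spanned A"
    and nondeg: "\<And>x. x \<in> A \<Longrightarrow> (\<And>y. y \<in> A \<Longrightarrow> \<omega> x y = 0) \<Longrightarrow> x = 0"
    and f: "linear f"
  shows "\<exists>p\<in>A. \<forall>x\<in>A. \<omega> p x = f x"
proof -
  obtain C where C: "independent C" "finite C" "span C = A" "card C = dim A"
    using finitely_spanned_basis[OF A] by blast
  have lin1: "linear (\<omega> v)" for v using bil by (simp add: bilinear_def)
  define T where "T v = (\<Sum>b\<in>C. \<omega> v b *\<^sub>R b)" for v
  have T: "linear T"
    unfolding T_def linear_iff
    by (simp add: bilinear_ladd[OF bil] bilinear_lmul[OF bil] scaleR_left_distrib
        sum.distrib scaleR_sum_right)
  have coord: "u b = w b" if "(\<Sum>b\<in>C. u b *\<^sub>R b) = (\<Sum>b\<in>C. w b *\<^sub>R b)" "b \<in> C" for u w b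
  proof -
    have "(\<Sum>b\<in>C. (u b - w b) *\<^sub>R b) = 0"
      using that(1) by (simp add: scaleR_left_diff_distrib sum_subtractf)
    then have "u b - w b = 0"
      using independentD[OF C(1,2) order_refl, of "\<lambda>b. u b - w b"] that(2) by blast
    then show ?thesis by simp
  qed
  have combo: "(\<Sum>b\<in>C. u b *\<^sub>R b) \<in> A" for u
    unfolding C(3)[symmetric] by (intro span_sum span_scale) (rule span_base)
  have TA: "T v \<in> A" for v
    unfolding T_def by (rule combo)
  have ext: "\<forall>x\<in>A. g x = h x" if "linear g" "linear h" "\<And>b. b \<in> C \<Longrightarrow> g b = h b"
    for g h :: "'a \<Rightarrow> real"
    using linear_eq_on[OF that(1,2)] that(3) C(3) by blast
  have inj: "inj_on T A"
    unfolding linear_inj_on_iff_eq_0[OF T A(1)]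
  proof (intro ballI impI)
    fix v assume v: "v \<in> A" "T v = 0"
    have "\<omega> v b = 0" if "b \<in> C" for b
      using coord[of "\<omega> v" "\<lambda>_. 0" b] v(2) that by (simp add: T_def)
    then have "\<forall>x\<in>A. \<omega> v x = 0"
      using ext[OF lin1, of "\<lambda>_. 0"] by (simp add: linear_zero)
    then show "v = 0" using nondeg v(1) by blast
  qed
  have "independent (T ` C)"
    using linear_independent_injective_image[OF T C(1)] inj C(3) by blast
  then have "dim (T ` A) = card (T ` C)"
    using real_vector.dim_span_eq_card_independent linear_span_image[OF T, of C] C(3) by metis
  also have "\<dots> = dim A"
    using C(3,4) inj inj_on_subset[OF inj] span_superset[of C] by (metis card_image)
  finally have "T ` A = A"
    using subspace_eq_if_dim_le[of "T ` A" A] linear_subspace_image[OF T A(1)] A TA by auto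
  then obtain p where p: "p \<in> A" "T p = (\<Sum>b\<in>C. f b *\<^sub>R b)"
    using combo[of f] by (metis imageE)
  have "\<omega> p b = f b" if "b \<in> C" for b
    by (rule coord[OF _ that]) (use p(2) in \<open>simp only: T_def\<close>)
  then have "\<forall>x\<in>A. \<omega> p x = f x" by (rule ext[OF lin1 f])
  then show ?thesis using p(1) by blast
qed


section \<open>Polynomials in a linear map\<close>

text \<open>
  The vector \<open>p(T) v\<close>, by Horner's scheme.
\<close>

definition poly_act :: "('v::real_vector \<Rightarrow> 'v) \<Rightarrow> real poly \<Rightarrow> 'v \<Rightarrow> 'v" where
  "poly_act T p v = fold_coeffs (\<lambda>a w. a *\<^sub>R v + T w) p 0"

lemma poly_act_0 [simp]: "poly_act T 0 v = 0"
  by (simp add: poly_act_def)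

lemma poly_act_pCons:
  "linear T \<Longrightarrow> poly_act T (pCons a p) v = a *\<^sub>R v + T (poly_act T p v)"
  by (cases "a = 0 \<and> p = 0") (auto simp: poly_act_def linear_0)

lemma poly_act_add:
  "linear T \<Longrightarrow> poly_act T (p + q) v = poly_act T p v + poly_act T q v"
  by (induction p q rule: poly_induct2)
    (simp_all add: poly_act_pCons scaleR_left_distrib linear_add)

lemma poly_act_smult: "linear T \<Longrightarrow> poly_act T (smult c p) v = c *\<^sub>R poly_act T p v"
  by (induction p) (simp_all add: poly_act_pCons scaleR_right_distrib linear_scale)

lemma poly_act_sum: "linear T \<Longrightarrow> poly_act T (sum p I) v = (\<Sum>i\<in>I. poly_act T (p i) v)"
  by (induction I rule: infinite_finite_induct) (simp_all add: poly_act_add)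

lemma poly_act_mult:
  "linear T \<Longrightarrow> poly_act T (p * q) v = poly_act T p (poly_act T q v)"
  by (induction p) (simp_all add: poly_act_pCons poly_act_add poly_act_smult)

lemma poly_act_monom: "linear T \<Longrightarrow> poly_act T (monom c n) v = c *\<^sub>R (T ^^ n) v"
  by (induction n) (simp_all add: monom_0 monom_Suc poly_act_pCons linear_scale linear_0)

lemma linear_poly_act: "linear T \<Longrightarrow> linear (poly_act T p)"
proof (induction p)
  case 0
  then show ?case by (simp add: linear_iff)
next
  case (pCons a p)
  then have "linear (\<lambda>v. a *\<^sub>R v + T (poly_act T p v))"
    by (auto simp: linear_iff algebra_simps)
  then show ?case by (simp add: poly_act_pCons[OF pCons.prems])
qed

lemma poly_act_mem:
  assumes "linear T" "subspace V" "\<And>v. v \<in> V \<Longrightarrow> T v \<in> V" "v \<in> V"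
  shows "poly_act T p v \<in> V"
  using assms
  by (induction p) (simp_all add: poly_act_pCons subspace_0 subspace_add subspace_scale)

lemma poly_act_commute:
  assumes "linear T" "linear S" "subspace V" "\<And>v. v \<in> V \<Longrightarrow> T v \<in> V"
    and "\<And>v. v \<in> V \<Longrightarrow> S (T v) = T (S v)" "v \<in> V"
  shows "S (poly_act T p v) = poly_act T p (S v)"
  using assms
  by (induction p)
    (simp_all add: poly_act_pCons linear_0 linear_add linear_scale poly_act_mem)

text \<open>
  The derivation rule \<open>[X, p(T)] = p'(T) [X, T]\<close> when \<open>[X, T]\<close> commutes with \<open>T\<close>.
\<close>

lemma poly_act_commutator:
  assumes T: "linear T" and X: "linear X" and N: "linear N" and V: "subspace V"
    and TV: "\<And>v. v \<in> V \<Longrightarrow> T v \<in> V"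
    and XV: "\<And>v. v \<in> V \<Longrightarrow> X v \<in> V"
    and comm: "\<And>v. v \<in> V \<Longrightarrow> X (T v) = T (X v) + N v"
    and NT: "\<And>v. v \<in> V \<Longrightarrow> N (T v) = T (N v)" and v: "v \<in> V"
  shows "X (poly_act T p v) = poly_act T p (X v) + poly_act T (pderiv p) (N v)"
proof (induction p)
  case 0
  show ?case by (simp add: linear_0 X)
next
  case (pCons a p)
  have mem: "poly_act T p v \<in> V" using poly_act_mem T V TV v by blast
  have "X (poly_act T (pCons a p) v)
      = a *\<^sub>R X v + (T (X (poly_act T p v)) + N (poly_act T p v))"
    by (simp add: poly_act_pCons T X linear_add linear_scale comm[OF mem])
  also have "N (poly_act T p v) = poly_act T p (N v)"
    using poly_act_commute[OF T N V TV NT v] .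
  finally show ?case
    by (simp add: pCons.IH poly_act_pCons T pderiv_pCons poly_act_add linear_add)
qed

text \<open>
  The \<open>dim V + 1\<close> vectors \<open>v, T v, T\<^sup>2 v, \<dots>\<close> satisfy a linear relation.
\<close>

lemma annihilator_of_vector:
  assumes T: "linear T" and V: "finitely_spanned V"
    and TV: "\<And>v. v \<in> V \<Longrightarrow> T v \<in> V" and v: "v \<in> V"
  shows "\<exists>p. p \<noteq> 0 \<and> poly_act T p v = 0"
proof -
  obtain B where B: "finite B" "V \<subseteq> span B"
    using V unfolding finitely_spanned_def by blast
  let ?g = "\<lambda>i. (T ^^ i) v"
  let ?n = "card B"
  have gV: "?g i \<in> V" for i by (induction i) (simp_all add: v TV)
  show ?thesis
  proof (cases "inj_on ?g {..?n}")
    case False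
    then obtain i j where ij: "?g i = ?g j" "i \<noteq> j" unfolding inj_on_def by blast
    let ?p = "monom 1 i + monom (- 1) j :: real poly"
    have "coeff ?p i = 1" using ij(2) by simp
    then have "?p \<noteq> 0" by force
    moreover have "poly_act T ?p v = 0"
      using ij(1) by (simp add: poly_act_add poly_act_monom T)
    ultimately show ?thesis by blast
  next
    case True
    let ?S = "?g ` {..?n}"
    have "dependent ?S"
    proof (rule ccontr)
      assume "independent ?S"
      then have "card ?S \<le> card B"
        using real_vector.independent_span_bound[OF B(1)] gV B(2) by blast
      then show False using True by (simp add: card_image)
    qed
    then obtain u where u: "\<exists>w\<in>?S. u w \<noteq> 0" "(\<Sum>w\<in>?S. u w *\<^sub>R w) = 0"
      using dependent_finite[of ?S] by blast
    let ?p = "\<Sum>i\<le>?n. monom (u (?g i)) i"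
    obtain i where i: "i \<le> ?n" "u (?g i) \<noteq> 0" using u(1) by auto
    have "coeff ?p i = u (?g i)"
      using i(1) by (simp add: coeff_sum coeff_monom)
    then have "?p \<noteq> 0" using i(2) by force
    moreover have "poly_act T ?p v = 0"
      using u(2) True by (simp add: poly_act_sum poly_act_monom T sum.reindex)
    ultimately show ?thesis by blast
  qed
qed

lemma annihilator_of_subspace:
  assumes T: "linear T" and V: "subspace V" "finitely_spanned V"
    and TV: "\<And>v. v \<in> V \<Longrightarrow> T v \<in> V"
  shows "\<exists>p. p \<noteq> 0 \<and> (\<forall>v\<in>V. poly_act T p v = 0)"
proof -
  obtain C where C: "finite C" "span C = V"
    using finitely_spanned_basis[OF V] by blast
  have "\<exists>p. p \<noteq> 0 \<and> (\<forall>v\<in>C'. poly_act T p v = 0)" if "finite C'" "C' \<subseteq> V" for C'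
    using that
  proof (induction C')
    case empty
    show ?case by (rule exI[of _ 1]) simp
  next
    case (insert c C')
    then have C': "C' \<subseteq> V" "c \<in> V" by auto
    obtain p where p: "p \<noteq> 0" "\<forall>v\<in>C'. poly_act T p v = 0"
      using insert.IH[OF C'(1)] by blast
    obtain q where q: "q \<noteq> 0" "poly_act T q c = 0"
      using annihilator_of_vector[OF T V(2) TV C'(2)] by blast
    have "poly_act T (p * q) c = 0"
      using q(2) linear_0[OF linear_poly_act[OF T]] by (simp add: poly_act_mult[OF T])
    moreover have "poly_act T (q * p) v = 0" if "v \<in> C'" for v
      using p(2) that linear_0[OF linear_poly_act[OF T]] by (simp add: poly_act_mult[OF T])
    ultimately have "\<forall>v\<in>insert c C'. poly_act T (q * p) v = 0"
      by (simp add: mult.commute[of q p])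
    then show ?case using p(1) q(1) by (intro exI[of _ "q * p"]) simp
  qed
  then obtain p where p: "p \<noteq> 0" "\<forall>v\<in>C. poly_act T p v = 0"
    using C span_superset by metis
  have "\<forall>v\<in>V. poly_act T p v = 0"
    using linear_eq_on[OF linear_poly_act[OF T] linear_zero, of _ C] p(2) C(2) by auto
  then show ?thesis using p(1) by blast
qed

lemma minimal_annihilator:
  assumes T: "linear T" and V: "subspace V" "finitely_spanned V" "V \<noteq> {0}"
    and TV: "\<And>v. v \<in> V \<Longrightarrow> T v \<in> V"
  obtains p where "degree p > 0" "\<And>v. v \<in> V \<Longrightarrow> poly_act T p v = 0"
    and "\<And>q. q \<noteq> 0 \<Longrightarrow> degree q < degree p \<Longrightarrow> \<exists>v\<in>V. poly_act T q v \<noteq> 0"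
proof -
  let ?Q = "\<lambda>p. p \<noteq> 0 \<and> (\<forall>v\<in>V. poly_act T p v = 0)"
  obtain p where p: "?Q p" "\<And>q. ?Q q \<Longrightarrow> degree p \<le> degree q"
    using ex_has_least_nat[of ?Q _ degree] annihilator_of_subspace[OF T V(1,2) TV] by blast
  have "degree p \<noteq> 0"
  proof
    assume "degree p = 0"
    then obtain c where c: "p = [:c:]" by (metis degree_eq_zeroE)
    obtain v where "v \<in> V" "v \<noteq> 0" using V(1,3) subspace_0 by blast
    then show False using p(1) c by (auto simp: poly_act_pCons[OF T] linear_0[OF T])
  qed
  then show thesis using that p by (metis leD neq0_conv)
qed

text \<open>
  This replaces the trace computation of the usual proof of Lie's theorem. Let \<open>p\<close> be the minimal
  polynomial of \<open>T\<close>. Then \<open>0 = [X, p(T)] = p'(T) N = N p'(T)\<close>; if \<open>N\<close> were injective, \<open>p'(T)\<close> would vanish,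
  although \<open>p'\<close> is nonzero of smaller degree (characteristic zero).
\<close>

lemma commutator_singular:
  assumes T: "linear T" and X: "linear X" and N: "linear N"
    and V: "subspace V" "finitely_spanned V" "V \<noteq> {0}"
    and TV: "\<And>v. v \<in> V \<Longrightarrow> T v \<in> V"
    and XV: "\<And>v. v \<in> V \<Longrightarrow> X v \<in> V"
    and comm: "\<And>v. v \<in> V \<Longrightarrow> X (T v) = T (X v) + N v"
    and NT: "\<And>v. v \<in> V \<Longrightarrow> N (T v) = T (N v)"
  shows "\<exists>v\<in>V. v \<noteq> 0 \<and> N v = 0"
proof -
  obtain p where p: "degree p > 0" "\<And>v. v \<in> V \<Longrightarrow> poly_act T p v = 0"
    "\<And>q. q \<noteq> 0 \<Longrightarrow> degree q < degree p \<Longrightarrow> \<exists>v\<in>V. poly_act T q v \<noteq> 0"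
    using minimal_annihilator[OF T V TV] by blast
  have "pderiv p \<noteq> 0" "degree (pderiv p) < degree p"
    using p(1) by (auto simp: pderiv_eq_0_iff degree_pderiv)
  then obtain v where v: "v \<in> V" "poly_act T (pderiv p) v \<noteq> 0" using p(3) by blast
  have "N (poly_act T (pderiv p) v) = poly_act T (pderiv p) (N v)"
    using poly_act_commute[OF T N V(1) TV NT v(1)] .
  also have "\<dots> = 0"
    using poly_act_commutator[OF T X N V(1) TV XV comm NT v(1), of p] p(2) v(1) XV
    by (simp add: linear_0[OF X])
  finally show ?thesis using v poly_act_mem[OF T V(1) TV v(1)] by blast
qed

text \<open>
  A complex root \<open>\<gamma> + i \<delta>\<close> of \<open>p\<close> gives the linear factor if \<open>\<delta> = 0\<close>, and otherwise its real
  quadratic \<open>(X - \<gamma>)\<^sup>2 + \<delta>\<^sup>2\<close>: the remainder of \<open>p\<close> modulo it has degree at most one and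
  vanishes at a non-real number, so it is zero.
\<close>

lemma real_poly_factor:
  fixes p :: "real poly"
  assumes "degree p > 0"
  shows "\<exists>\<gamma> \<delta>. [:- \<gamma>, 1:] dvd p \<or> [:\<gamma>\<^sup>2 + \<delta>\<^sup>2, - (2 * \<gamma>), 1:] dvd p"
proof -
  let ?c = "map_poly complex_of_real"
  have c_add: "?c (f + g) = ?c f + ?c g" for f g
    by (rule poly_eqI) (simp add: coeff_map_poly)
  have c_smult: "?c (smult a f) = smult (complex_of_real a) (?c f)" for a f
    by (rule poly_eqI) (simp add: coeff_map_poly)
  have c_mult: "?c (f * g) = ?c f * ?c g" for f g
    by (induction f) (simp_all add: c_add c_smult map_poly_pCons)
  have c_real: "poly (?c f) (complex_of_real x) = complex_of_real (poly f x)" for f x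
    by (induction f) (simp_all add: map_poly_pCons)
  have "\<not> constant (poly (?c p))"
    using assms by (simp add: constant_degree degree_map_poly)
  then obtain z where z: "poly (?c p) z = 0" using fundamental_theorem_of_algebra by blast
  show ?thesis
  proof (cases "Im z = 0")
    case True
    then have "z = complex_of_real (Re z)" by (simp add: complex_eq_iff)
    then have "complex_of_real (poly p (Re z)) = 0"
      using z c_real by metis
    then show ?thesis by (auto simp: poly_eq_0_iff_dvd)
  next
    case False
    let ?q = "[:(Re z)\<^sup>2 + (Im z)\<^sup>2, - (2 * Re z), 1:]"
    let ?r = "p mod ?q"
    have qz: "poly (?c ?q) z = 0"
      by (simp add: map_poly_pCons complex_eq_iff power2_eq_square algebra_simps)
    have "?c p = ?c (p div ?q) * ?c ?q + ?c ?r"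
      by (metis div_mult_mod_eq c_add c_mult)
    then have rz: "poly (?c ?r) z = 0" using z qz by simp
    have "degree ?r < 2" using degree_mod_less[of ?q p] by auto
    then have "?r = [:coeff ?r 0, coeff ?r 1:]"
      by (intro poly_eqI) (auto simp: coeff_pCons coeff_eq_0 split: nat.split)
    then obtain a b where r: "?r = [:a, b:]" by blast
    then have "complex_of_real a + z * complex_of_real b = 0"
      using rz by (simp add: map_poly_pCons)
    then have "?r = 0" using False r by (auto simp: complex_eq_iff)
    then have "?q dvd p" by (simp add: dvd_eq_mod_eq_0)
    then show ?thesis by blast
  qed
qed

text \<open>
  The identity says \<open>(T - \<gamma>)\<^sup>2 v = - \<delta>\<^sup>2 v\<close>. In this form real eigenvectors are covered by
  \<open>\<delta> = 0\<close>.
\<close>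

lemma exists_quadratic_vector:
  assumes T: "linear T" and V: "subspace V" "finitely_spanned V" "V \<noteq> {0}"
    and TV: "\<And>v. v \<in> V \<Longrightarrow> T v \<in> V"
  shows "\<exists>\<gamma> \<delta>. \<exists>v\<in>V. v \<noteq> 0 \<and> T (T v) = (2 * \<gamma>) *\<^sub>R T v - (\<gamma>\<^sup>2 + \<delta>\<^sup>2) *\<^sub>R v"
proof -
  obtain p where p: "degree p > 0" "\<And>v. v \<in> V \<Longrightarrow> poly_act T p v = 0"
    "\<And>q. q \<noteq> 0 \<Longrightarrow> degree q < degree p \<Longrightarrow> \<exists>v\<in>V. poly_act T q v \<noteq> 0"
    using minimal_annihilator[OF T V TV] by blast
  have kernel: "\<exists>v\<in>V. v \<noteq> 0 \<and> poly_act T q v = 0" if "q dvd p" "degree q > 0" for q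
  proof -
    obtain r where r: "p = q * r" using \<open>q dvd p\<close> by blast
    have "r \<noteq> 0" "q \<noteq> 0" using r p(1) by auto
    then have "degree r < degree p" using r that(2) by (simp add: degree_mult_eq)
    then obtain v where v: "v \<in> V" "poly_act T r v \<noteq> 0" using p(3) \<open>r \<noteq> 0\<close> by blast
    have "poly_act T q (poly_act T r v) = 0" using p(2) v(1) r by (simp flip: poly_act_mult[OF T])
    then show ?thesis using v poly_act_mem[OF T V(1) TV v(1)] by blast
  qed
  obtain \<gamma> \<delta> where "[:- \<gamma>, 1:] dvd p \<or> [:\<gamma>\<^sup>2 + \<delta>\<^sup>2, - (2 * \<gamma>), 1:] dvd p"
    using real_poly_factor[OF p(1)] by blast
  then consider "[:- \<gamma>, 1:] dvd p" | "[:\<gamma>\<^sup>2 + \<delta>\<^sup>2, - (2 * \<gamma>), 1:] dvd p" by blast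
  then show ?thesis
  proof cases
    case 1
    then obtain v where v: "v \<in> V" "v \<noteq> 0" "poly_act T [:- \<gamma>, 1:] v = 0" using kernel by force
    then have "T v = \<gamma> *\<^sub>R v" by (simp add: poly_act_pCons T linear_0)
    then have "T (T v) = (2 * \<gamma>) *\<^sub>R T v - (\<gamma>\<^sup>2 + 0\<^sup>2) *\<^sub>R v"
      by (simp add: T linear_scale power2_eq_square flip: scaleR_diff_left)
    then show ?thesis using v by blast
  next
    case 2
    then obtain v where v: "v \<in> V" "v \<noteq> 0"
      "poly_act T [:\<gamma>\<^sup>2 + \<delta>\<^sup>2, - (2 * \<gamma>), 1:] v = 0" using kernel by force
    then have "T (T v) = (2 * \<gamma>) *\<^sub>R T v - (\<gamma>\<^sup>2 + \<delta>\<^sup>2) *\<^sub>R v"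
      by (simp add: poly_act_pCons T linear_0 linear_add linear_scale linear_diff algebra_simps
          add_eq_0_iff)
    then show ?thesis using v by blast
  qed
qed

section \<open>Irreducible modules of solvable Lie algebras\<close>

text \<open>
  The identities hold on the whole type, and all brackets lie in \<open>L\<close>; this is what a bracket on \<open>L\<close>
  becomes after composition with a projection onto \<open>L\<close>.
\<close>

locale total_lie_algebra =
  fixes L :: "'g::real_vector set" and br :: "'g \<Rightarrow> 'g \<Rightarrow> 'g"
  assumes subspace_L: "subspace L"
    and finitely_spanned_L: "finitely_spanned L"
    and bilinear_br: "bilinear br"
    and br_mem: "br x y \<in> L"
    and br_self [simp]: "br x x = 0"
    and jacobi_br: "br x (br y z) + br y (br z x) + br z (br x y) = 0"
begin

lemmas br_simps = bilinear_ladd[OF bilinear_br] bilinear_radd[OF bilinear_br]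
  bilinear_lmul[OF bilinear_br] bilinear_rmul[OF bilinear_br]
  bilinear_lneg[OF bilinear_br] bilinear_rneg[OF bilinear_br]
  bilinear_lsub[OF bilinear_br] bilinear_rsub[OF bilinear_br]
  bilinear_lzero[OF bilinear_br] bilinear_rzero[OF bilinear_br]

lemma br_skew: "br y x = - br x y"
proof -
  have "br x y + br y x = 0"
    using br_self[of "x + y"]
    by (simp only: br_simps br_self[of x] br_self[of y] add_0 add_0_right add.commute)
  then show ?thesis by (simp add: eq_neg_iff_add_eq_0 add.commute)
qed

lemma br_derivation: "br w (br x y) = br (br w x) y + br x (br w y)"
proof -
  have "br w (br x y) + br x (br y w) + br y (br w x) = 0" by (rule jacobi_br)
  moreover have "br x (br y w) = - br x (br w y)"
    using br_skew[of y w] by (simp add: br_simps)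
  moreover have "br y (br w x) = - br (br w x) y" by (rule br_skew)
  ultimately show ?thesis by (simp add: algebra_simps)
qed

lemma lie_ideal_L: "lie_ideal L br L"
  using subspace_L br_mem by (simp add: lie_ideal_def)

lemma lie_ideal_derived_algebra:
  assumes "lie_ideal L br S"
  shows "lie_ideal L br (derived_algebra br S)"
proof -
  let ?G = "{br x y | x y. x \<in> S \<and> y \<in> S}"
  have S: "x \<in> L \<Longrightarrow> y \<in> S \<Longrightarrow> br x y \<in> S" for x y
    using assms by (auto simp: lie_ideal_def)
  have "br w v \<in> span ?G" if "w \<in> L" "v \<in> span ?G" for w v
  proof -
    have "subspace {v. br w v \<in> span ?G}"
      by (auto simp: subspace_def br_simps span_zero span_add span_scale)
    moreover have "?G \<subseteq> {v. br w v \<in> span ?G}"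
    proof
      fix u assume "u \<in> ?G"
      then obtain x y where u: "u = br x y" "x \<in> S" "y \<in> S" by blast
      have "br (br w x) y \<in> ?G" "br x (br w y) \<in> ?G" using S that(1) u(2,3) by blast+
      then have "br (br w x) y + br x (br w y) \<in> span ?G"
        by (intro span_add span_base)
      then show "u \<in> {v. br w v \<in> span ?G}" by (simp add: u(1) flip: br_derivation)
    qed
    ultimately show ?thesis using span_minimal that(2) by blast
  qed
  moreover have "span ?G \<subseteq> L"
    by (rule span_minimal) (use subspace_L br_mem in auto)
  ultimately show ?thesis by (simp add: lie_ideal_def derived_algebra_def)
qed

lemma lie_ideal_derived_series: "lie_ideal L br ((derived_algebra br ^^ n) L)"
  by (induction n) (simp_all add: lie_ideal_L lie_ideal_derived_algebra)

end

locale lie_module = total_lie_algebra L br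
  for L :: "'g::real_vector set" and br :: "'g \<Rightarrow> 'g \<Rightarrow> 'g" +
  fixes V :: "'v::real_vector set" and \<rho> :: "'g \<Rightarrow> 'v \<Rightarrow> 'v"
  assumes bilinear_rho: "bilinear \<rho>"
    and subspace_V: "subspace V"
    and finitely_spanned_V: "finitely_spanned V"
    and rho_mem: "x \<in> L \<Longrightarrow> v \<in> V \<Longrightarrow> \<rho> x v \<in> V"
    and rho_br: "x \<in> L \<Longrightarrow> y \<in> L \<Longrightarrow> v \<in> V \<Longrightarrow> \<rho> (br x y) v = \<rho> x (\<rho> y v) - \<rho> y (\<rho> x v)"
begin

definition submodule :: "'v set \<Rightarrow> bool" where
  "submodule U \<longleftrightarrow> subspace U \<and> U \<subseteq> V \<and> (\<forall>x\<in>L. \<forall>v\<in>U. \<rho> x v \<in> U)"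

lemma linear_rho: "linear (\<rho> x)"
  using bilinear_rho by (simp add: bilinear_def)

lemmas rho_simps = bilinear_ladd[OF bilinear_rho] bilinear_radd[OF bilinear_rho]
  bilinear_lmul[OF bilinear_rho] bilinear_rmul[OF bilinear_rho]
  bilinear_lsub[OF bilinear_rho] bilinear_rsub[OF bilinear_rho]
  bilinear_lzero[OF bilinear_rho] bilinear_rzero[OF bilinear_rho]

lemma submodule_kernel:
  assumes f: "linear f"
    and comm: "\<And>x v. x \<in> L \<Longrightarrow> v \<in> V \<Longrightarrow> f (\<rho> x v) = \<rho> x (f v)"
  shows "submodule {v \<in> V. f v = 0}"
  using subspace_V rho_mem comm
  by (auto simp: submodule_def subspace_def linear_0[OF f] linear_add[OF f] linear_scale[OF f]
      rho_simps)

end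

locale irreducible_lie_module = lie_module +
  assumes V_nonzero: "V \<noteq> {0}"
    and irreducible: "submodule U \<Longrightarrow> U \<noteq> {0} \<Longrightarrow> U = V"
begin

text \<open>
  Schur's lemma: the kernel is a nonzero submodule.
\<close>

lemma vanishes_if_commutes_and_singular:
  assumes "linear f" and "\<And>x v. x \<in> L \<Longrightarrow> v \<in> V \<Longrightarrow> f (\<rho> x v) = \<rho> x (f v)"
    and "\<exists>v\<in>V. v \<noteq> 0 \<and> f v = 0" and "v \<in> V"
  shows "f v = 0"
  using irreducible[OF submodule_kernel[OF assms(1,2)]] assms(3,4) by blast

text \<open>
  The union \<open>G\<close> of the kernels of the powers of \<open>c = [x, y]\<close> is a submodule, because \<open>[w, c]\<close> lies in
  the ideal and so commutes with \<open>c\<close>: passing \<open>w\<close> through a power of \<open>c\<close> costs one power. By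
  \<open>commutator_singular\<close> it is nonzero.
\<close>

lemma locally_nilpotent_commutator:
  assumes a: "lie_ideal L br \<aa>"
    and comm: "\<And>a b v. a \<in> \<aa> \<Longrightarrow> b \<in> \<aa> \<Longrightarrow> v \<in> V \<Longrightarrow> \<rho> a (\<rho> b v) = \<rho> b (\<rho> a v)"
    and x: "x \<in> L" and y: "y \<in> \<aa>" and v: "v \<in> V"
  shows "\<exists>m. (\<rho> (br x y) ^^ m) v = 0"
proof -
  define c where "c = br x y"
  have yL: "y \<in> L" and cL: "c \<in> L" and ca: "c \<in> \<aa>"
    using a x y br_mem by (auto simp: lie_ideal_def c_def)
  have pow_mem: "(\<rho> c ^^ m) v \<in> V" if "v \<in> V" for m v
    using that by (induction m) (simp_all add: rho_mem cL)
  have pow_lin: "linear (\<rho> c ^^ m)" for m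
    by (induction m) (simp_all add: linear_iff rho_simps)
  define G where "G = {v \<in> V. \<exists>m. (\<rho> c ^^ m) v = 0}"
  have pow_up: "(\<rho> c ^^ (m + k)) v = 0" if "(\<rho> c ^^ m) v = 0" for m k v
    using that linear_0[OF pow_lin] by (simp add: add.commute[of m] funpow_add)
  \<comment> \<open>By induction on \<open>m\<close>, writing \<open>c w = w c - [w, c]\<close> and using that \<open>[w, c]\<close> commutes with \<open>c\<close>.\<close>
  have shift: "(\<rho> c ^^ Suc m) (\<rho> w v) = 0"
    if w: "w \<in> L" and v: "v \<in> V" "(\<rho> c ^^ m) v = 0" for w v m
    using v
  proof (induction m arbitrary: v)
    case 0
    then show ?case by (simp add: rho_simps)
  next
    case (Suc m)
    have wc: "br w c \<in> \<aa>" using a w ca by (simp add: lie_ideal_def)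
    have *: "(\<rho> c ^^ k) (\<rho> (br w c) v) = \<rho> (br w c) ((\<rho> c ^^ k) v)" for k
      by (induction k) (simp_all add: comm[OF ca wc] pow_mem Suc.prems)
    have "\<rho> c (\<rho> w v) = \<rho> w (\<rho> c v) - \<rho> (br w c) v"
      using rho_br[OF w cL Suc.prems(1)] by simp
    then have "(\<rho> c ^^ Suc (Suc m)) (\<rho> w v)
        = (\<rho> c ^^ Suc m) (\<rho> w (\<rho> c v)) - (\<rho> c ^^ Suc m) (\<rho> (br w c) v)"
      by (simp only: funpow_Suc_right o_apply linear_diff[OF pow_lin] linear_diff[OF linear_rho])
    also have "(\<rho> c ^^ Suc m) (\<rho> w (\<rho> c v)) = 0"
      using Suc.IH[of "\<rho> c v"] Suc.prems rho_mem[OF cL]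
      by (simp only: funpow_Suc_right o_apply)
    also have "(\<rho> c ^^ Suc m) (\<rho> (br w c) v) = 0"
      using *[of "Suc m"] Suc.prems(2) by (simp only: rho_simps)
    finally show ?case by simp
  qed
  have "submodule G"
    unfolding submodule_def subspace_def
  proof (intro conjI ballI allI)
    show "0 \<in> G" using subspace_0[OF subspace_V] by (auto simp: G_def intro!: exI[of _ 0])
    show "G \<subseteq> V" by (auto simp: G_def)
    fix u v assume uv: "u \<in> G" "v \<in> G"
    then obtain m k where mk: "(\<rho> c ^^ m) u = 0" "(\<rho> c ^^ k) v = 0" by (auto simp: G_def)
    have "(\<rho> c ^^ (m + k)) (u + v) = 0"
      using pow_up[OF mk(1), of k] pow_up[OF mk(2), of m]
      by (simp add: linear_add[OF pow_lin] add.commute)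
    then show "u + v \<in> G" using uv subspace_add[OF subspace_V] by (auto simp: G_def)
  next
    fix r v assume "v \<in> G"
    then show "r *\<^sub>R v \<in> G"
      using subspace_scale[OF subspace_V] by (auto simp: G_def linear_scale[OF pow_lin])
  next
    fix w v assume "w \<in> L" "v \<in> G"
    then show "\<rho> w v \<in> G" using shift rho_mem unfolding G_def by blast
  qed
  moreover have "\<exists>v\<in>V. v \<noteq> 0 \<and> \<rho> c v = 0"
  proof (rule commutator_singular[OF linear_rho[of y] linear_rho[of x] linear_rho
        subspace_V finitely_spanned_V V_nonzero])
    show "\<rho> x (\<rho> y v) = \<rho> y (\<rho> x v) + \<rho> c v" if "v \<in> V" for v
      using rho_br[OF x yL that] by (simp add: c_def)
    show "\<rho> c (\<rho> y v) = \<rho> y (\<rho> c v)" if "v \<in> V" for v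
      using comm[OF ca y that] .
  qed (use rho_mem x yL in auto)
  then have "G \<noteq> {0}" unfolding G_def by (force intro: exI[of _ 1])
  ultimately have "G = V" by (rule irreducible)
  then show ?thesis using v by (auto simp: G_def c_def)
qed

text \<open>
  The vectors killed by all commutators \<open>[w, b]\<close> with \<open>b\<close> in the ideal form a submodule \<open>K\<close>. It
  is nonzero: on a minimal \<open>\<aa>\<close>-stable subspace \<open>U\<close>, a commutator is locally nilpotent, so its kernel
  in \<open>U\<close> is nonzero and \<open>\<aa>\<close>-stable, hence all of \<open>U\<close>.
\<close>

lemma commutator_with_commuting_ideal_vanishes:
  assumes a: "lie_ideal L br \<aa>"
    and comm: "\<And>a b v. a \<in> \<aa> \<Longrightarrow> b \<in> \<aa> \<Longrightarrow> v \<in> V \<Longrightarrow> \<rho> a (\<rho> b v) = \<rho> b (\<rho> a v)"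
    and x: "x \<in> L" and y: "y \<in> \<aa>" and v: "v \<in> V"
  shows "\<rho> (br x y) v = 0"
proof -
  have aL: "b \<in> L" if "b \<in> \<aa>" for b using a that by (auto simp: lie_ideal_def)
  have bra: "br w b \<in> \<aa>" if "w \<in> L" "b \<in> \<aa>" for w b using a that by (auto simp: lie_ideal_def)
  define K where "K = {v \<in> V. \<forall>w\<in>L. \<forall>b\<in>\<aa>. \<rho> (br w b) v = 0}"
  have "submodule K"
    unfolding submodule_def
  proof (intro conjI ballI)
    show "subspace K"
      using subspace_V by (auto simp: K_def subspace_def rho_simps)
    show "K \<subseteq> V" by (auto simp: K_def)
    fix u v assume u: "u \<in> L" and v: "v \<in> K"
    have vV: "v \<in> V" using v by (simp add: K_def)
    have "\<rho> (br w b) (\<rho> u v) = 0" if "w \<in> L" "b \<in> \<aa>" for w b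
    proof -
      have "\<rho> (br u (br w b)) v = 0" "\<rho> (br w b) v = 0"
        using v u that bra by (auto simp: K_def)
      then show ?thesis
        using rho_br[OF u br_mem vV, of w b] by (simp add: rho_simps)
    qed
    then show "\<rho> u v \<in> K" using rho_mem[OF u vV] by (simp add: K_def)
  qed
  moreover have "K \<noteq> {0}"
  proof -
    obtain U where U: "\<forall>b\<in>\<aa>. \<forall>u\<in>U. \<rho> b u \<in> U" "subspace U" "U \<subseteq> V" "U \<noteq> {0}"
      and min: "\<And>W. \<forall>b\<in>\<aa>. \<forall>u\<in>W. \<rho> b u \<in> W \<Longrightarrow> subspace W \<Longrightarrow> W \<subseteq> U \<Longrightarrow> W \<noteq> {0} \<Longrightarrow> W = U"
      by (rule minimal_nonzero_subspace[of "\<lambda>U. \<forall>b\<in>\<aa>. \<forall>u\<in>U. \<rho> b u \<in> U" V])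
        (use aL rho_mem subspace_V finitely_spanned_V V_nonzero in auto)
    obtain u where u: "u \<in> U" "u \<noteq> 0" using U(2,4) subspace_0 by blast
    have "\<rho> (br w b) t = 0" if w: "w \<in> L" and b: "b \<in> \<aa>" and t: "t \<in> U" for w b t
    proof -
      let ?n = "\<rho> (br w b)"
      define W where "W = {t \<in> U. ?n t = 0}"
      have n: "br w b \<in> \<aa>" using bra w b .
      have "\<forall>b\<in>\<aa>. \<forall>u\<in>W. \<rho> b u \<in> W"
        using U(1,3) comm[OF n] by (auto simp: W_def rho_simps subset_iff)
      moreover have "subspace W" using U(2) by (auto simp: W_def subspace_def rho_simps)
      moreover have "W \<subseteq> U" by (auto simp: W_def)
      moreover have "W \<noteq> {0}"
      proof -
        have "\<exists>m. (?n ^^ m) u = 0"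
          using locally_nilpotent_commutator[OF a comm w b] u(1) U(3) by blast
        then obtain m where m: "(?n ^^ m) u = 0" "\<And>k. k < m \<Longrightarrow> (?n ^^ k) u \<noteq> 0"
          using exists_least_iff[of "\<lambda>m. (?n ^^ m) u = 0"] by blast
        obtain k where k: "m = Suc k" using m(1) u(2) by (cases m) auto
        have "(?n ^^ k) u \<in> U" by (induction k) (use u(1) U(1) n in auto)
        moreover have "?n ((?n ^^ k) u) = 0" using m(1) k by simp
        moreover have "(?n ^^ k) u \<noteq> 0" using m(2) k by simp
        ultimately show ?thesis by (auto simp: W_def)
      qed
      ultimately have "W = U" by (rule min)
      then show ?thesis using t by (auto simp: W_def)
    qed
    then have "u \<in> K" using u(1) U(3) by (auto simp: K_def)
    then show ?thesis using u(2) by auto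
  qed
  ultimately have "K = V" by (rule irreducible)
  then show ?thesis using v x y by (auto simp: K_def)
qed

text \<open>
  An operator that commutes with the action and is a commutator is singular, hence zero.
\<close>

lemma central_commutator_vanishes:
  assumes x: "x \<in> L" and y: "y \<in> L" and v: "v \<in> V"
    and comm: "\<And>w v. w \<in> L \<Longrightarrow> v \<in> V \<Longrightarrow> \<rho> (br x y) (\<rho> w v) = \<rho> w (\<rho> (br x y) v)"
  shows "\<rho> (br x y) v = 0"
proof (rule vanishes_if_commutes_and_singular[OF linear_rho comm _ v])
  show "\<exists>v\<in>V. v \<noteq> 0 \<and> \<rho> (br x y) v = 0"
  proof (rule commutator_singular[OF linear_rho[of y] linear_rho[of x] linear_rho
        subspace_V finitely_spanned_V V_nonzero])
    show "\<rho> x (\<rho> y v) = \<rho> y (\<rho> x v) + \<rho> (br x y) v" if "v \<in> V" for v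
      using rho_br[OF x y that] by simp
  qed (use rho_mem x y comm in auto)
qed

text \<open>
  Let the \<open>k\<close>-th term of the derived series, with \<open>L\<close> as the \<open>0\<close>-th, be the first that acts by zero. If \<open>k \<ge> 2\<close>, the
  preceding term acts by commuting operators, so its commutators with \<open>L\<close> act by zero and its
  elements commute with the action of \<open>L\<close>. Being spanned by commutators, it then acts by zero,
  contradicting the choice of \<open>k\<close>. So \<open>k \<le> 1\<close>, and \<open>[x, y]\<close> acts by zero.
\<close>

lemma solvable_acts_commutatively:
  assumes solv: "solvable_lie L br" and x: "x \<in> L" and y: "y \<in> L" and v: "v \<in> V"
  shows "\<rho> x (\<rho> y v) = \<rho> y (\<rho> x v)"
proof -
  let ?D = "\<lambda>n. (derived_algebra br ^^ n) L"
  let ?Q = "\<lambda>n. \<forall>x\<in>?D n. \<forall>v\<in>V. \<rho> x v = 0"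
  have ideal: "lie_ideal L br (?D n)" for n by (rule lie_ideal_derived_series)
  have DL: "?D n \<subseteq> L" for n using ideal[of n] by (simp add: lie_ideal_def)
  have brD: "br x y \<in> ?D (Suc n)" if "x \<in> ?D n" "y \<in> ?D n" for n x y
    using that by (auto simp: derived_algebra_def intro: span_base)
  have "\<exists>n. ?Q n" using solv by (force simp: solvable_lie_def rho_simps)
  define k where "k = (LEAST n. ?Q n)"
  have k: "?Q k" unfolding k_def by (rule LeastI_ex) fact
  have k_least: "\<not> ?Q j" if "j < k" for j
    using that unfolding k_def by (rule not_less_Least)
  have "k \<le> 1"
  proof (rule ccontr)
    assume "\<not> k \<le> 1"
    then have "k = Suc (Suc (k - 2))" by simp
    then obtain j where j: "k = Suc (Suc j)" by blast
    have comm: "\<rho> a (\<rho> b v) = \<rho> b (\<rho> a v)"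
      if "a \<in> ?D (Suc j)" "b \<in> ?D (Suc j)" "v \<in> V" for a b v
    proof -
      have "br a b \<in> ?D k" unfolding j by (rule brD[OF that(1,2)])
      then have "\<rho> (br a b) v = 0" using k that(3) by blast
      moreover have "a \<in> L" "b \<in> L" using that(1,2) DL[of "Suc j"] by blast+
      ultimately show ?thesis using rho_br[of a b v] that(3) by simp
    qed
    have gen: "\<rho> (br x y) v = 0" if xy: "x \<in> ?D j" "y \<in> ?D j" and v: "v \<in> V" for x y v
    proof (rule central_commutator_vanishes[OF _ _ v])
      show "x \<in> L" "y \<in> L" using xy DL by blast+
      fix w v assume w: "w \<in> L" and v: "v \<in> V"
      have "\<rho> (br w (br x y)) v = 0"
        using commutator_with_commuting_ideal_vanishes[OF ideal comm w brD[OF xy] v] .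
      then show "\<rho> (br x y) (\<rho> w v) = \<rho> w (\<rho> (br x y) v)"
        using rho_br[OF w br_mem v, of x y] by simp
    qed
    have "\<rho> z v = 0" if z: "z \<in> ?D (Suc j)" and v: "v \<in> V" for z v
    proof -
      have "z \<in> span {br x y |x y. x \<in> ?D j \<and> y \<in> ?D j}"
        using z by (simp add: derived_algebra_def)
      moreover have "span {br x y |x y. x \<in> ?D j \<and> y \<in> ?D j} \<subseteq> {z. \<rho> z v = 0}"
        by (rule span_minimal)
          (use gen[OF _ _ v] in \<open>auto simp: subspace_def rho_simps\<close>)
      ultimately show ?thesis by blast
    qed
    then show False using k_least[of "Suc j"] j by blast
  qed
  then consider "k = 0" | "k = Suc 0" by linarith
  then have "br x y \<in> ?D k"
    by cases (use br_mem brD[of x 0 y] x y in auto)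
  then have "\<rho> (br x y) v = 0" using k v by blast
  then show ?thesis using rho_br[OF x y v] by simp
qed

text \<open>
  Every \<open>y \<in> L\<close> satisfies \<open>(y - \<gamma>)\<^sup>2 = - \<delta>\<^sup>2\<close> on \<open>V\<close>. If some \<open>y\<^sub>0\<close> is not a scalar, then
  \<open>J = (y\<^sub>0 - \<gamma>\<^sub>0) / \<delta>\<^sub>0\<close> has square \<open>-1\<close> and commutes with everything, so for any other \<open>y\<close> one has
  \<open>(y - \<gamma> - \<delta> J) (y - \<gamma> + \<delta> J) = 0\<close>, and by Schur's lemma one of the factors vanishes. The plane is
  spanned by any \<open>v\<^sub>0\<close> and \<open>J v\<^sub>0\<close>.
\<close>

lemma solvable_line_or_complex_plane:
  assumes solv: "solvable_lie L br"
  obtains (line) e where "e \<in> V" "e \<noteq> 0" "\<And>x. x \<in> L \<Longrightarrow> \<exists>\<alpha>. \<rho> x e = \<alpha> *\<^sub>R e"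
  | (plane) e0 e1 where "e0 \<in> V" "e1 \<in> V"
    "\<And>s t. s *\<^sub>R e0 + t *\<^sub>R e1 = 0 \<Longrightarrow> s = 0 \<and> t = 0"
    "\<And>x. x \<in> L \<Longrightarrow> \<exists>\<alpha> \<beta>. \<rho> x e0 = \<alpha> *\<^sub>R e0 + \<beta> *\<^sub>R e1 \<and> \<rho> x e1 = - \<beta> *\<^sub>R e0 + \<alpha> *\<^sub>R e1"
proof -
  note comm = solvable_acts_commutatively[OF solv]
  obtain v0 where v0: "v0 \<in> V" "v0 \<noteq> 0" using V_nonzero subspace_0[OF subspace_V] by blast
  define S where "S y \<gamma> v = \<rho> y v - \<gamma> *\<^sub>R v" for y and \<gamma> :: real and v
  have S_lin: "linear (S y \<gamma>)" for y \<gamma>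
    by (simp add: linear_iff S_def rho_simps algebra_simps)
  have S_mem: "S y \<gamma> v \<in> V" if "y \<in> L" "v \<in> V" for y \<gamma> v
    unfolding S_def using that by (simp add: subspace_diff subspace_scale subspace_V rho_mem)
  have S_comm: "S y \<gamma> (\<rho> x v) = \<rho> x (S y \<gamma> v)" if "y \<in> L" "x \<in> L" "v \<in> V" for x y \<gamma> v
    using comm[OF that] by (simp add: S_def rho_simps)
  have square: "\<exists>\<gamma> \<delta>. \<forall>v\<in>V. S y \<gamma> (S y \<gamma> v) = - (\<delta>\<^sup>2) *\<^sub>R v" if y: "y \<in> L" for y
  proof -
    obtain \<gamma> \<delta> w where w: "w \<in> V" "w \<noteq> 0"
      "\<rho> y (\<rho> y w) = (2 * \<gamma>) *\<^sub>R \<rho> y w - (\<gamma>\<^sup>2 + \<delta>\<^sup>2) *\<^sub>R w"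
      using exists_quadratic_vector[OF linear_rho subspace_V finitely_spanned_V V_nonzero
          rho_mem[OF y]] by blast
    define f where "f v = S y \<gamma> (S y \<gamma> v) + (\<delta>\<^sup>2) *\<^sub>R v" for v
    have "f w = \<rho> y (\<rho> y w) - (\<gamma> + \<gamma>) *\<^sub>R \<rho> y w + (\<gamma>\<^sup>2 + \<delta>\<^sup>2) *\<^sub>R w"
      by (simp only: f_def S_def rho_simps power2_eq_square scaleR_left_distrib scaleR_diff_right
          scaleR_scaleR) (simp add: algebra_simps)
    then have "f w = 0" using w(3) by simp
    moreover have "linear f"
      using S_lin[of y \<gamma>] by (simp add: linear_iff f_def algebra_simps)
    moreover have "f (\<rho> x v) = \<rho> x (f v)" if "x \<in> L" "v \<in> V" for x v
      using that y by (simp add: f_def S_comm S_mem rho_simps)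
    ultimately have "f v = 0" if "v \<in> V" for v
      using vanishes_if_commutes_and_singular[of f v] w(1,2) that by blast
    then have "\<forall>v\<in>V. S y \<gamma> (S y \<gamma> v) = - (\<delta>\<^sup>2) *\<^sub>R v"
      by (simp add: f_def eq_neg_iff_add_eq_0)
    then show ?thesis by blast
  qed
  show thesis
  proof (cases "\<forall>y\<in>L. \<exists>\<gamma>. \<forall>v\<in>V. \<rho> y v = \<gamma> *\<^sub>R v")
    case True
    then show thesis using line[OF v0] v0(1) by blast
  next
    case False
    then obtain y0 where y0: "y0 \<in> L" and nonscalar: "\<And>\<gamma>. \<exists>v\<in>V. \<rho> y0 v \<noteq> \<gamma> *\<^sub>R v"
      by blast
    obtain \<gamma>0 \<delta>0 where sq0: "\<And>v. v \<in> V \<Longrightarrow> S y0 \<gamma>0 (S y0 \<gamma>0 v) = - (\<delta>0\<^sup>2) *\<^sub>R v"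
      using square[OF y0] by blast
    obtain w where w: "w \<in> V" "S y0 \<gamma>0 w \<noteq> 0"
      using nonscalar[of \<gamma>0] by (auto simp: S_def)
    have "\<delta>0 \<noteq> 0"
    proof
      assume "\<delta>0 = 0"
      then have "S y0 \<gamma>0 (S y0 \<gamma>0 w) = 0" using sq0[OF w(1)] by simp
      then have "\<exists>v\<in>V. v \<noteq> 0 \<and> S y0 \<gamma>0 v = 0" using w S_mem[OF y0 w(1)] by blast
      then have "S y0 \<gamma>0 w = 0"
        using vanishes_if_commutes_and_singular[OF S_lin S_comm[OF y0]] w(1) by blast
      then show False using w(2) by simp
    qed
    define J where "J v = (1 / \<delta>0) *\<^sub>R S y0 \<gamma>0 v" for v
    have J_lin: "linear J"
      using S_lin[of y0 \<gamma>0] by (simp add: linear_iff J_def algebra_simps)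
    have J_mem: "J v \<in> V" if "v \<in> V" for v
      unfolding J_def using S_mem[OF y0 that] by (simp add: subspace_scale subspace_V)
    have JJ: "J (J v) = - v" if "v \<in> V" for v
      using sq0[OF that] \<open>\<delta>0 \<noteq> 0\<close>
      by (simp add: J_def linear_scale[OF S_lin] power2_eq_square)
    have J_comm: "J (\<rho> x v) = \<rho> x (J v)" if "x \<in> L" "v \<in> V" for x v
      using S_comm[OF y0 that] by (simp add: J_def rho_simps)
    have complex: "\<exists>\<gamma> \<delta>. \<forall>v\<in>V. \<rho> y v = \<gamma> *\<^sub>R v + \<delta> *\<^sub>R J v" if y: "y \<in> L" for y
    proof -
      obtain \<gamma> \<delta> where sq: "\<And>v. v \<in> V \<Longrightarrow> S y \<gamma> (S y \<gamma> v) = - (\<delta>\<^sup>2) *\<^sub>R v"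
        using square[OF y] by blast
      define f where "f v = S y \<gamma> v - \<delta> *\<^sub>R J v" for v
      have f_lin: "linear f"
        using S_lin[of y \<gamma>] J_lin by (simp add: linear_iff f_def algebra_simps)
      have f_comm: "f (\<rho> x v) = \<rho> x (f v)" if "x \<in> L" "v \<in> V" for x v
        using that y by (simp add: f_def S_comm J_comm rho_simps)
      have JS: "J (S y \<gamma> v) = S y \<gamma> (J v)" if "v \<in> V" for v
        using J_comm[OF y that] by (simp add: S_def linear_diff[OF J_lin] linear_scale[OF J_lin])
      have factor: "f (S y \<gamma> v + \<delta> *\<^sub>R J v) = 0" if "v \<in> V" for v
        by (simp add: f_def linear_add[OF S_lin] linear_scale[OF S_lin] linear_add[OF J_lin]
            linear_scale[OF J_lin] sq[OF that] JJ[OF that] JS[OF that] power2_eq_square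
            algebra_simps)
      show ?thesis
      proof (cases "\<exists>v\<in>V. S y \<gamma> v + \<delta> *\<^sub>R J v \<noteq> 0")
        case True
        then obtain u where u: "u \<in> V" "S y \<gamma> u + \<delta> *\<^sub>R J u \<noteq> 0" by blast
        have "S y \<gamma> u + \<delta> *\<^sub>R J u \<in> V"
          using u(1) S_mem[OF y] J_mem subspace_V by (simp add: subspace_add subspace_scale)
        then have "f v = 0" if "v \<in> V" for v
          using vanishes_if_commutes_and_singular[OF f_lin f_comm _ that] factor[OF u(1)] u(2)
          by blast
        then have "\<forall>v\<in>V. \<rho> y v = \<gamma> *\<^sub>R v + \<delta> *\<^sub>R J v" by (simp add: f_def S_def algebra_simps)
        then show ?thesis by blast
      next
        case False
        then have "\<forall>v\<in>V. \<rho> y v = \<gamma> *\<^sub>R v + (- \<delta>) *\<^sub>R J v"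
          by (simp add: S_def algebra_simps)
        then show ?thesis by blast
      qed
    qed
    show thesis
    proof (rule plane[OF v0(1) J_mem[OF v0(1)]])
      fix s t :: real assume st: "s *\<^sub>R v0 + t *\<^sub>R J v0 = 0"
      then have "J (s *\<^sub>R v0 + t *\<^sub>R J v0) = 0" using linear_0[OF J_lin] by simp
      then have "s *\<^sub>R J v0 = t *\<^sub>R v0"
        by (simp add: linear_add[OF J_lin] linear_scale[OF J_lin] JJ v0(1))
      then have "s *\<^sub>R (s *\<^sub>R v0) + t *\<^sub>R (t *\<^sub>R v0) = s *\<^sub>R (s *\<^sub>R v0 + t *\<^sub>R J v0)"
        by (simp add: scaleR_add_right) (metis mult.commute scaleR_scaleR)
      then have "(s * s + t * t) *\<^sub>R v0 = 0" using st by (simp add: scaleR_add_left)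
      then show "s = 0 \<and> t = 0" using v0(2) by (simp add: sum_squares_eq_zero_iff)
    next
      fix x assume x: "x \<in> L"
      then obtain \<gamma> \<delta> where "\<And>v. v \<in> V \<Longrightarrow> \<rho> x v = \<gamma> *\<^sub>R v + \<delta> *\<^sub>R J v"
        using complex by blast
      then have "\<rho> x v0 = \<gamma> *\<^sub>R v0 + \<delta> *\<^sub>R J v0" "\<rho> x (J v0) = - \<delta> *\<^sub>R v0 + \<gamma> *\<^sub>R J v0"
        using v0(1) J_mem JJ by simp_all
      then show "\<exists>\<alpha> \<beta>. \<rho> x v0 = \<alpha> *\<^sub>R v0 + \<beta> *\<^sub>R J v0 \<and>
          \<rho> x (J v0) = - \<beta> *\<^sub>R v0 + \<alpha> *\<^sub>R J v0" by blast
    qed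
  qed
qed

end

text \<open>
  A nonzero ideal of minimal dimension inside \<open>I\<close> is irreducible under the adjoint action.
\<close>

lemma (in total_lie_algebra) ideal_contains_line_or_complex_plane:
  assumes solv: "solvable_lie L br" and I: "lie_ideal L br I" "I \<noteq> {0}"
  obtains (line) e where "e \<in> I" "e \<noteq> 0" "\<And>x. x \<in> L \<Longrightarrow> \<exists>\<alpha>. br x e = \<alpha> *\<^sub>R e"
  | (plane) e0 e1 where "e0 \<in> I" "e1 \<in> I"
    "\<And>s t. s *\<^sub>R e0 + t *\<^sub>R e1 = 0 \<Longrightarrow> s = 0 \<and> t = 0"
    "\<And>x. x \<in> L \<Longrightarrow> \<exists>\<alpha> \<beta>. br x e0 = \<alpha> *\<^sub>R e0 + \<beta> *\<^sub>R e1 \<and> br x e1 = - \<beta> *\<^sub>R e0 + \<alpha> *\<^sub>R e1"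
proof -
  have I': "subspace I" "finitely_spanned I"
    using I finitely_spanned_mono[OF finitely_spanned_L] by (auto simp: lie_ideal_def)
  obtain V where V: "lie_ideal L br V" "subspace V" "V \<subseteq> I" "V \<noteq> {0}"
    and min: "\<And>W. lie_ideal L br W \<Longrightarrow> subspace W \<Longrightarrow> W \<subseteq> V \<Longrightarrow> W \<noteq> {0} \<Longrightarrow> W = V"
    by (rule minimal_nonzero_subspace[of "lie_ideal L br" I]) (use I I' in auto)
  have VL: "V \<subseteq> L" using V(1) by (simp add: lie_ideal_def)
  interpret lie_module L br V br
  proof
    show "finitely_spanned V" using finitely_spanned_mono[OF I'(2) V(3)] .
    show "br (br x y) v = br x (br y v) - br y (br x v)" for x y v
      using br_derivation[of x y v] by (simp add: algebra_simps)
  qed (use bilinear_br V(1) in \<open>auto simp: lie_ideal_def\<close>)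
  interpret irreducible_lie_module L br V br
  proof
    fix U assume "submodule U" "U \<noteq> {0}"
    then show "U = V" using min[of U] VL by (auto simp: submodule_def lie_ideal_def)
  qed (rule V(4))
  show thesis
  proof (rule solvable_line_or_complex_plane[OF solv])
    fix e assume "e \<in> V" "e \<noteq> 0" and e: "\<And>x. x \<in> L \<Longrightarrow> \<exists>\<alpha>. br x e = \<alpha> *\<^sub>R e"
    then show thesis by (intro line[OF _ _ e]) (use V(3) in auto)
  next
    fix e0 e1 assume e: "e0 \<in> V" "e1 \<in> V"
      "\<And>s t. s *\<^sub>R e0 + t *\<^sub>R e1 = 0 \<Longrightarrow> s = 0 \<and> t = 0"
      "\<And>x. x \<in> L \<Longrightarrow>
        \<exists>\<alpha> \<beta>. br x e0 = \<alpha> *\<^sub>R e0 + \<beta> *\<^sub>R e1 \<and> br x e1 = - \<beta> *\<^sub>R e0 + \<alpha> *\<^sub>R e1"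
    have "e0 \<in> I" "e1 \<in> I" using e(1,2) V(3) by auto
    then show thesis by (rule plane[OF _ _ e(3,4)])
  qed
qed

section \<open>Symplectic reduction\<close>

lemma derived_algebra_subset:
  assumes "subspace T" and "\<And>x y. x \<in> S \<Longrightarrow> y \<in> S \<Longrightarrow> br x y \<in> T"
  shows "derived_algebra br S \<subseteq> T"
  unfolding derived_algebra_def by (rule span_minimal) (use assms in auto)

locale total_symplectic_lie_algebra = total_lie_algebra L br
  for L :: "'g::real_vector set" and br :: "'g \<Rightarrow> 'g \<Rightarrow> 'g" +
  fixes \<omega> :: "'g \<Rightarrow> 'g \<Rightarrow> real"
  assumes bilinear_om: "bilinear \<omega>"
    and om_skew: "\<omega> x y = - \<omega> y x"
    and om_nondegenerate: "x \<in> L \<Longrightarrow> (\<And>y. y \<in> L \<Longrightarrow> \<omega> x y = 0) \<Longrightarrow> x = 0"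
    and om_closed: "\<omega> (br x y) z + \<omega> (br y z) x + \<omega> (br z x) y = 0"
begin

lemmas om_simps = bilinear_ladd[OF bilinear_om] bilinear_radd[OF bilinear_om]
  bilinear_lmul[OF bilinear_om] bilinear_rmul[OF bilinear_om]
  bilinear_lneg[OF bilinear_om] bilinear_rneg[OF bilinear_om]
  bilinear_lsub[OF bilinear_om] bilinear_rsub[OF bilinear_om]
  bilinear_lzero[OF bilinear_om] bilinear_rzero[OF bilinear_om]

lemma linear_om: "linear (\<omega> x)"
  using bilinear_om by (simp add: bilinear_def)

lemma om_self [simp]: "\<omega> x x = 0"
  using om_skew[of x x] by simp

lemma om_zero_commute: "\<omega> x y = 0 \<Longrightarrow> \<omega> y x = 0"
  using om_skew[of y x] by simp

lemma symplectic_lie_algebra_on_L: "symplectic_lie_algebra_on L br \<omega>"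
proof
  show "\<exists>B. finite B \<and> span B = L"
    using finitely_spanned_basis[OF subspace_L finitely_spanned_L] by metis
  show "bilinear_between L L br" "bilinear_between L UNIV \<omega>"
    by (simp_all add: bilinear_between_def linear_between_def br_mem br_simps om_simps)
  show "x = 0" if "x \<in> L" "\<And>y. y \<in> L \<Longrightarrow> \<omega> x y = 0" for x
    using om_nondegenerate that .
qed (rule subspace_L br_self jacobi_br om_skew om_closed)+

text \<open>
  Closedness of \<open>\<omega>\<close> makes \<open>J\<^sup>\<bottom>\<close> a subalgebra, although it need not be an ideal.
\<close>

lemma symp_perp_closed:
  assumes J: "lie_ideal L br J" and x: "x \<in> symp_perp L \<omega> J" and y: "y \<in> symp_perp L \<omega> J"
  shows "br x y \<in> symp_perp L \<omega> J"
proof -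
  have "\<omega> (br x y) j = 0" if j: "j \<in> J" for j
  proof -
    have "br x j \<in> J" "br y j \<in> J" using J x y j by (auto simp: lie_ideal_def symp_perp_def)
    then have "\<omega> x (br y j) = 0" "\<omega> y (br x j) = 0" using x y by (auto simp: symp_perp_def)
    then have "\<omega> (br y j) x = 0" "\<omega> (br j x) y = 0"
      using om_skew[of "br y j" x] om_skew[of "br x j" y] br_skew[of j x]
      by (simp_all add: om_simps)
    then show ?thesis using om_closed[of x y j] by simp
  qed
  then show ?thesis by (simp add: symp_perp_def br_mem)
qed

text \<open>
  The subspace \<open>A\<close> represents \<open>J\<^sup>\<bottom> / J\<close>, and \<open>\<pi>\<close> restricted to \<open>J\<^sup>\<bottom>\<close> is the quotient map. The
  reduced bracket inherits all identities because brackets with \<open>J\<close> stay in \<open>J\<close>, which \<open>\<pi>\<close> kills, and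
  because \<open>J\<close> is orthogonal to \<open>A\<close>. Solvability passes to the subalgebra \<open>J\<^sup>\<bottom>\<close> and to its quotient.
\<close>

lemma symplectic_reduction:
  assumes J: "lie_ideal L br J"
    and A: "subspace A" "A \<subseteq> symp_perp L \<omega> J"
    and nondeg: "\<And>x. x \<in> A \<Longrightarrow> (\<And>y. y \<in> A \<Longrightarrow> \<omega> x y = 0) \<Longrightarrow> x = 0"
    and pi: "linear \<pi>" "\<And>v. v \<in> symp_perp L \<omega> J \<Longrightarrow> \<pi> v \<in> A"
      "\<And>v. v \<in> symp_perp L \<omega> J \<Longrightarrow> v - \<pi> v \<in> J"
      "\<And>j. j \<in> J \<Longrightarrow> \<pi> j = 0" "\<And>x. x \<in> A \<Longrightarrow> \<pi> x = x"
  shows reduction_symplectic: "symplectic_lie_algebra_on A (\<lambda>x y. \<pi> (br x y)) \<omega>"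
    and reduction_solvable: "solvable_lie L br \<Longrightarrow> solvable_lie A (\<lambda>x y. \<pi> (br x y))"
proof -
  let ?M = "symp_perp L \<omega> J"
  have A_perp: "x \<in> ?M" if "x \<in> A" for x using A(2) that by blast
  have perp_L: "x \<in> L" if "x \<in> ?M" for x using that by (simp add: symp_perp_def)
  have AL: "A \<subseteq> L" using A(2) by (auto simp: symp_perp_def)
  note pi_simps = linear_add[OF pi(1)] linear_diff[OF pi(1)] linear_scale[OF pi(1)]
    linear_0[OF pi(1)] linear_neg[OF pi(1)]
  have orth: "\<omega> j x = 0" if "j \<in> J" "x \<in> A" for j x
    using A(2) that om_zero_commute by (auto simp: symp_perp_def)
  have brM: "br x y \<in> ?M" if "x \<in> ?M" "y \<in> ?M" for x y
    using symp_perp_closed[OF J that] .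
  have pi_br: "\<pi> (br x (\<pi> y)) = \<pi> (br x y)" if x: "x \<in> L" and y: "y \<in> ?M" for x y
  proof -
    have "br x (y - \<pi> y) \<in> J" using J x pi(3)[OF y] by (simp add: lie_ideal_def)
    then have "\<pi> (br x (y - \<pi> y)) = 0" by (rule pi(4))
    then show ?thesis by (simp add: br_simps pi_simps)
  qed
  have om_pi: "\<omega> (\<pi> v) x = \<omega> v x" if "v \<in> ?M" "x \<in> A" for v x
    using orth[OF pi(3)[OF that(1)] that(2)] by (simp add: om_simps)
  show "symplectic_lie_algebra_on A (\<lambda>x y. \<pi> (br x y)) \<omega>"
  proof
    show "subspace A" by fact
    show "\<exists>B. finite B \<and> span B = A"
      using finitely_spanned_basis[OF A(1) finitely_spanned_mono[OF finitely_spanned_L AL]]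
      by metis
    show "bilinear_between A A (\<lambda>x y. \<pi> (br x y))"
      by (simp add: bilinear_between_def linear_between_def br_simps pi_simps pi(2) brM A_perp)
    show "bilinear_between A UNIV \<omega>"
      by (simp add: bilinear_between_def linear_between_def om_simps)
    show "\<pi> (br x x) = 0" for x by (simp add: pi_simps)
    show "\<omega> x y = - \<omega> y x" for x y by (rule om_skew)
    show "x = 0" if "x \<in> A" "\<And>y. y \<in> A \<Longrightarrow> \<omega> x y = 0" for x using nondeg that .
    fix x y z assume xyz: "x \<in> A" "y \<in> A" "z \<in> A"
    have "\<pi> (br x (br y z)) + \<pi> (br y (br z x)) + \<pi> (br z (br x y)) = 0"
      using jacobi_br[of x y z] by (simp add: pi_simps flip: linear_add[OF pi(1)])
    then show "\<pi> (br x (\<pi> (br y z))) + \<pi> (br y (\<pi> (br z x))) + \<pi> (br z (\<pi> (br x y))) = 0"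
      using xyz by (simp add: pi_br brM A_perp perp_L)
    show "\<omega> (\<pi> (br x y)) z + \<omega> (\<pi> (br y z)) x + \<omega> (\<pi> (br z x)) y = 0"
      using om_closed[of x y z] xyz by (simp add: om_pi brM A_perp)
  qed
  show "solvable_lie A (\<lambda>x y. \<pi> (br x y))" if solv: "solvable_lie L br"
  proof -
    let ?br = "\<lambda>x y. \<pi> (br x y)"
    have mono: "(derived_algebra ?br ^^ n) A \<subseteq> \<pi> ` ((derived_algebra br ^^ n) L \<inter> ?M)" for n
    proof (induction n)
      case 0
      show ?case
      proof
        fix x assume "x \<in> (derived_algebra ?br ^^ 0) A"
        then have "x \<in> A" by simp
        then have "x = \<pi> x" "x \<in> L \<inter> ?M" using pi(5) AL A(2) by auto
        then show "x \<in> \<pi> ` ((derived_algebra br ^^ 0) L \<inter> ?M)" by (simp add: image_eqI)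
      qed
    next
      case (Suc n)
      let ?S = "(derived_algebra br ^^ n) L" and ?T = "(derived_algebra br ^^ Suc n) L"
      have M: "subspace ?M"
        using subspace_L by (auto simp: symp_perp_def subspace_def om_simps)
      have "subspace (\<pi> ` (?T \<inter> ?M))"
        using lie_ideal_derived_series[of "Suc n"] M
        by (intro linear_subspace_image[OF pi(1)] subspace_inter) (auto simp: lie_ideal_def)
      moreover have "?br x y \<in> \<pi> ` (?T \<inter> ?M)"
        if xy: "x \<in> (derived_algebra ?br ^^ n) A" "y \<in> (derived_algebra ?br ^^ n) A" for x y
      proof -
        obtain s t where st: "s \<in> ?S \<inter> ?M" "t \<in> ?S \<inter> ?M" "x = \<pi> s" "y = \<pi> t"
          using Suc.IH xy by blast
        have "\<pi> (br (\<pi> s) (\<pi> t)) = \<pi> (br (\<pi> s) t)"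
          using pi_br[of "\<pi> s" t] st pi(2) A_perp perp_L by auto
        also have "\<dots> = - \<pi> (br t (\<pi> s))" using br_skew[of "\<pi> s" t] by (simp add: pi_simps)
        also have "\<dots> = - \<pi> (br t s)" using pi_br[of t s] st perp_L by auto
        also have "\<dots> = \<pi> (br s t)" using br_skew[of s t] by (simp add: pi_simps)
        finally have "?br x y = \<pi> (br s t)" using st by simp
        moreover have "br s t \<in> ?T"
          using st by (auto simp: derived_algebra_def intro: span_base)
        ultimately show ?thesis using brM[of s t] st by blast
      qed
      ultimately have "derived_algebra ?br ((derived_algebra ?br ^^ n) A) \<subseteq> \<pi> ` (?T \<inter> ?M)"
        by (rule derived_algebra_subset)
      then show ?case by (simp only: funpow.simps o_apply)
    qed
    obtain n where n: "(derived_algebra br ^^ n) L = {0}" using solv by (auto simp: solvable_lie_def)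
    have "(derived_algebra ?br ^^ n) A \<subseteq> {0}"
      using mono[of n] n by (auto simp: pi_simps)
    moreover have "0 \<in> (derived_algebra ?br ^^ n) A"
      by (cases n) (simp_all add: derived_algebra_def span_zero subspace_0[OF A(1)])
    ultimately show ?thesis unfolding solvable_lie_def by blast
  qed
qed

lemma lie_ideal_span:
  assumes "E \<subseteq> L" and "\<And>x e. x \<in> L \<Longrightarrow> e \<in> E \<Longrightarrow> br x e \<in> span E"
  shows "lie_ideal L br (span E)"
proof -
  have "br x v \<in> span E" if "x \<in> L" "v \<in> span E" for x v
  proof -
    have "span E \<subseteq> {v. br x v \<in> span E}"
      by (rule span_minimal)
        (use assms(2) that(1) in \<open>auto simp: subspace_def br_simps span_zero span_add span_scale\<close>)
    then show ?thesis using that(2) by blast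
  qed
  then show ?thesis
    using span_minimal[OF assms(1) subspace_L] by (simp add: lie_ideal_def)
qed

lemma symp_perp_span: "symp_perp L \<omega> (span E) = {x \<in> L. \<forall>e\<in>E. \<omega> x e = 0}"
proof -
  have "(\<forall>v\<in>span E. \<omega> x v = 0) \<longleftrightarrow> (\<forall>e\<in>E. \<omega> x e = 0)" for x
    using linear_eq_0_on_span[OF linear_om[of x], of E] span_base[of _ E] by blast
  then show ?thesis by (simp add: symp_perp_def)
qed

end

section \<open>Isomorphic copies and extension of the structure to the whole type\<close>

text \<open>
  The axioms for a double extension need no separate verification: they follow from those of the
  given algebra once the coordinate map is known to respect brackets and forms.
\<close>

lemma symplectic_lie_algebra_on_transport:
  assumes "symplectic_lie_algebra_on L br \<omega>"
    and f: "linear_between L L' f" "bij_betw f L L'"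
    and hom: "\<And>x y. x \<in> L \<Longrightarrow> y \<in> L \<Longrightarrow> f (br x y) = br' (f x) (f y)"
    and om: "\<And>x y. x \<in> L \<Longrightarrow> y \<in> L \<Longrightarrow> \<omega>' (f x) (f y) = \<omega> x y"
  shows "symplectic_lie_algebra_on L' br' \<omega>'"
proof -
  interpret symplectic_lie_algebra_on L br \<omega> by fact
  have L': "L' = f ` L" using f(2) by (simp add: bij_betw_def)
  have f_add: "f (x + y) = f x + f y" if "x \<in> L" "y \<in> L" for x y
    using f(1) that by (simp add: linear_between_def)
  have f_scale: "f (c *\<^sub>R x) = c *\<^sub>R f x" if "x \<in> L" for c x
    using f(1) that by (simp add: linear_between_def)
  have L0: "0 \<in> L" and L_add: "\<And>x y. x \<in> L \<Longrightarrow> y \<in> L \<Longrightarrow> x + y \<in> L"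
    and L_scale: "\<And>c x. x \<in> L \<Longrightarrow> c *\<^sub>R x \<in> L"
    using subspace_carrier by (auto simp: subspace_def)
  have f0: "f 0 = 0" using f_scale[OF L0, of 0] by simp
  have br_L: "br x y \<in> L" if "x \<in> L" "y \<in> L" for x y
    using bilinear_bracket that by (simp add: bilinear_between_def linear_between_def)
  have br_add: "br (x + y) z = br x z + br y z" "br z (x + y) = br z x + br z y"
    if "x \<in> L" "y \<in> L" "z \<in> L" for x y z
    using bilinear_bracket that by (simp_all add: bilinear_between_def linear_between_def)
  have br_scale: "br (c *\<^sub>R x) z = c *\<^sub>R br x z" "br z (c *\<^sub>R x) = c *\<^sub>R br z x"
    if "x \<in> L" "z \<in> L" for c x z
    using bilinear_bracket that by (simp_all add: bilinear_between_def linear_between_def)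
  have om_add: "\<omega> (x + y) z = \<omega> x z + \<omega> y z" "\<omega> z (x + y) = \<omega> z x + \<omega> z y"
    if "x \<in> L" "y \<in> L" "z \<in> L" for x y z
    using bilinear_form that by (simp_all add: bilinear_between_def linear_between_def)
  have om_scale: "\<omega> (c *\<^sub>R x) z = c * \<omega> x z" "\<omega> z (c *\<^sub>R x) = c * \<omega> z x"
    if "x \<in> L" "z \<in> L" for c x z
    using bilinear_form that by (simp_all add: bilinear_between_def linear_between_def)
  show ?thesis
  proof
    show "subspace L'"
      unfolding L' subspace_def
    proof (intro conjI ballI allI)
      show "0 \<in> f ` L" using L0 f0 by (metis imageI)
      show "u + v \<in> f ` L" if uv: "u \<in> f ` L" "v \<in> f ` L" for u v
        using uv by (auto simp: L_add simp flip: f_add)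
      show "c *\<^sub>R u \<in> f ` L" if u: "u \<in> f ` L" for c u
        using u by (auto simp: L_scale simp flip: f_scale)
    qed
    show "\<exists>B. finite B \<and> span B = L'"
    proof -
      obtain B where B: "finite B" "span B = L" using finite_dim_carrier by blast
      have sub: "subspace L'" by fact
      have "v \<in> L \<and> f v \<in> span (f ` B)" if "v \<in> span B" for v
        using that
      proof (induction rule: span_induct_alt)
        case base
        show ?case by (simp add: L0 f0 span_zero)
      next
        case (step c x y)
        have "x \<in> L" using step(1) B(2) span_base by metis
        moreover have "f x \<in> span (f ` B)" using step(1) by (simp add: span_base)
        ultimately show ?case
          using step(2) by (simp add: f_add f_scale L_add L_scale span_add span_scale)
      qed
      then have "L' \<subseteq> span (f ` B)" using B(2) L' by auto
      moreover have "span (f ` B) \<subseteq> L'"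
        by (rule span_minimal[OF _ sub]) (use B(2) L' span_superset[of B] in auto)
      ultimately show ?thesis using B(1) by blast
    qed
    show "bilinear_between L' L' br'"
      unfolding bilinear_between_def linear_between_def L'
      by (simp add: br_L br_add br_scale L_add L_scale flip: hom f_add f_scale)
    show "bilinear_between L' UNIV \<omega>'"
      unfolding bilinear_between_def linear_between_def L'
      by (simp add: om om_add om_scale L_add L_scale flip: f_add f_scale)
    show "br' u u = 0" if "u \<in> L'" for u
      using that by (auto simp: L' f0 bracket_self simp flip: hom)
    show "\<omega>' u v = - \<omega>' v u" if uv: "u \<in> L'" "v \<in> L'" for u v
    proof -
      obtain x y where "x \<in> L" "y \<in> L" "u = f x" "v = f y" using uv L' by blast
      then show ?thesis using skew_form[of x y] by (simp add: om)
    qed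
    show "u = 0" if u: "u \<in> L'" "\<And>v. v \<in> L' \<Longrightarrow> \<omega>' u v = 0" for u
    proof -
      obtain x where x: "x \<in> L" "u = f x" using u(1) L' by blast
      have "\<omega> x y = 0" if "y \<in> L" for y
        using u(2)[of "f y"] x that L' om by auto
      then show ?thesis using nondegenerate_form[OF x(1)] f0 x(2) by simp
    qed
    fix u v w assume "u \<in> L'" "v \<in> L'" "w \<in> L'"
    then obtain x y z where *: "x \<in> L" "y \<in> L" "z \<in> L" "u = f x" "v = f y" "w = f z"
      using L' by auto
    show "br' u (br' v w) + br' v (br' w u) + br' w (br' u v) = 0"
      using * jacobi[of x y z] by (simp add: br_L L_add f0 flip: hom f_add)
    show "\<omega>' (br' u v) w + \<omega>' (br' v w) u + \<omega>' (br' w u) v = 0"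
      using * closed_form[of x y z] by (simp add: br_L om flip: hom)
  qed
qed

lemma projection_onto_subspace:
  assumes "subspace (L :: 'a::real_vector set)" "finitely_spanned L"
  obtains P where "linear P" "\<And>x. P x \<in> L" "\<And>x. x \<in> L \<Longrightarrow> P x = x"
proof -
  obtain C where C: "independent C" "span C = L"
    using finitely_spanned_basis[OF assms] by blast
  obtain P where P: "linear P" "\<forall>x\<in>C. P x = id x" "range P = span (id ` C)"
    using linear_independent_extend_subspace[OF C(1), of id] by blast
  have "P x = x" if "x \<in> L" for x
    using linear_eq_on[OF P(1) linear_id, of x C] P(2) that C(2) by simp
  moreover have "P x \<in> L" for x using P(3) C(2) by auto
  ultimately show thesis using that P(1) by blast
qed

text \<open>
  All identities on the whole type reduce to those on \<open>L\<close> because \<open>P\<close> fixes \<open>L\<close> pointwise, in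
  particular the values of the bracket.
\<close>

lemma total_symplectic_lie_algebra_projection:
  assumes "symplectic_lie_algebra_on L br \<omega>"
    and P: "linear P" "\<And>x. P x \<in> L" "\<And>x. x \<in> L \<Longrightarrow> P x = x"
  shows "total_symplectic_lie_algebra L (\<lambda>x y. br (P x) (P y)) (\<lambda>x y. \<omega> (P x) (P y))"
proof -
  interpret symplectic_lie_algebra_on L br \<omega> by fact
  have br_L: "br x y \<in> L" if "x \<in> L" "y \<in> L" for x y
    using bilinear_bracket that by (simp add: bilinear_between_def linear_between_def)
  show ?thesis
  proof
    show "subspace L" by (rule subspace_carrier)
    show "finitely_spanned L"
      using finite_dim_carrier by (auto simp: finitely_spanned_def)
    show "bilinear (\<lambda>x y. br (P x) (P y))"
      using bilinear_bracket P
      by (auto simp: bilinear_def linear_iff bilinear_between_def linear_between_def)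
    show "bilinear (\<lambda>x y. \<omega> (P x) (P y))"
      using bilinear_form P
      by (auto simp: bilinear_def linear_iff bilinear_between_def linear_between_def)
    show "\<omega> (P x) (P y) = - \<omega> (P y) (P x)" for x y by (rule skew_form[OF P(2) P(2)])
    show "x = 0" if "x \<in> L" "\<And>y. y \<in> L \<Longrightarrow> \<omega> (P x) (P y) = 0" for x
      using nondegenerate_form[OF that(1)] that P(3) by simp
  qed (simp_all add: P br_L bracket_self jacobi closed_form)
qed

lemma solvable_lie_cong:
  assumes "\<And>x y. x \<in> L \<Longrightarrow> y \<in> L \<Longrightarrow> br' x y = br x y"
    and "subspace L" "\<And>x y. x \<in> L \<Longrightarrow> y \<in> L \<Longrightarrow> br x y \<in> L"
  shows "solvable_lie L br' \<longleftrightarrow> solvable_lie L br"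
proof -
  have "(derived_algebra br' ^^ n) L = (derived_algebra br ^^ n) L
      \<and> (derived_algebra br ^^ n) L \<subseteq> L" for n
  proof (induction n)
    case (Suc n)
    let ?S = "(derived_algebra br ^^ n) L"
    have S: "?S \<subseteq> L" using Suc by blast
    have "{br' x y |x y. x \<in> ?S \<and> y \<in> ?S} = {br x y |x y. x \<in> ?S \<and> y \<in> ?S}"
      using assms(1) S by (metis (no_types, lifting) subsetD)
    then have "derived_algebra br' ?S = derived_algebra br ?S"
      by (simp only: derived_algebra_def)
    moreover have "derived_algebra br ?S \<subseteq> L"
      using assms(3) S by (intro derived_algebra_subset[OF assms(2)]) auto
    ultimately show ?case using Suc by simp
  qed simp
  then show ?thesis by (simp add: solvable_lie_def)
qed

lemma linear_between_if_linear: "linear f \<Longrightarrow> (\<And>x. x \<in> L \<Longrightarrow> f x \<in> M) \<Longrightarrow> linear_between L M f"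
  by (simp add: linear_between_def linear_add linear_scale)

lemma symplectic_lie_isomorphicI:
  assumes "linear_between L L' f" "bij_betw f L L'"
    and "\<And>x y. x \<in> L \<Longrightarrow> y \<in> L \<Longrightarrow> f (br x y) = br' (f x) (f y)"
    and "\<And>x y. x \<in> L \<Longrightarrow> y \<in> L \<Longrightarrow> \<omega>' (f x) (f y) = \<omega> x y"
  shows "symplectic_lie_isomorphic L br \<omega> L' br' \<omega>'"
  unfolding symplectic_lie_isomorphic_def by (rule exI[of _ f]) (use assms in simp)

section \<open>Reconstruction as a double extension\<close>

context total_symplectic_lie_algebra
begin

text \<open>
  In the decomposition \<open>v = \<omega>(v, e) d + \<pi> v + \<omega>(d, v) e\<close>, with \<open>\<omega>(d, e) = 1\<close>, the coefficients \<open>p\<close>,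
  \<open>q\<close>, \<open>D\<close>, \<open>\<epsilon>\<close> are read off from \<open>[x, e]\<close> and \<open>[d, x]\<close>. Closedness of \<open>\<omega>\<close> on \<open>(d, x, e)\<close> forces the
  \<open>d\<close>-component of \<open>[d, x]\<close>, and on \<open>(x, y, d)\<close> the \<open>e\<close>-component of \<open>[x, y]\<close>.
\<close>

theorem line_extension:
  assumes solv: "solvable_lie L br"
    and e: "e \<in> L" "e \<noteq> 0" "\<And>x. x \<in> L \<Longrightarrow> \<exists>\<alpha>. br x e = \<alpha> *\<^sub>R e"
  shows "\<exists>(A :: 'g set) br\<^sub>A \<omega>\<^sub>A. symplectic_lie_algebra_on A br\<^sub>A \<omega>\<^sub>A \<and> solvable_lie A br\<^sub>A \<and>
      double_extension_by_line L br \<omega> A br\<^sub>A \<omega>\<^sub>A"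
proof -
  obtain y where y: "y \<in> L" "\<omega> e y \<noteq> 0" using om_nondegenerate[OF e(1)] e(2) by blast
  define d where "d = (1 / \<omega> y e) *\<^sub>R y"
  have dL: "d \<in> L" using y(1) by (simp add: d_def subspace_scale subspace_L)
  have de: "\<omega> d e = 1" using y(2) om_skew[of e y] by (simp add: d_def om_simps)
  have ed: "\<omega> e d = - 1" using om_skew[of e d] de by simp
  define \<alpha> where "\<alpha> x = \<omega> d (br x e)" for x
  have br_e: "br x e = \<alpha> x *\<^sub>R e" if x: "x \<in> L" for x
  proof -
    obtain c where "br x e = c *\<^sub>R e" using e(3)[OF x] by blast
    then show ?thesis by (simp add: \<alpha>_def om_simps de)
  qed
  define \<pi> where "\<pi> v = v - \<omega> v e *\<^sub>R d - \<omega> d v *\<^sub>R e" for v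
  define A where "A = {x \<in> L. \<omega> x e = 0 \<and> \<omega> d x = 0}"
  have AL: "A \<subseteq> L" by (auto simp: A_def)
  have A: "subspace A"
    using subspace_L by (auto simp: A_def subspace_def om_simps)
  have Ae: "\<omega> x e = 0" "\<omega> e x = 0" "\<omega> d x = 0" "\<omega> x d = 0" if "x \<in> A" for x
    using that om_zero_commute by (auto simp: A_def)
  have pi_lin: "linear \<pi>"
    by (simp add: linear_iff \<pi>_def om_simps algebra_simps)
  have pi_A: "\<pi> v \<in> A" if "v \<in> L" for v
    using that dL e(1) subspace_L
    by (simp add: A_def \<pi>_def om_simps de subspace_diff subspace_scale)
  have pi_id: "\<pi> x = x" if "x \<in> A" for x using Ae[OF that] by (simp add: \<pi>_def)
  have pi_e: "\<pi> e = 0" and pi_d: "\<pi> d = 0" by (simp_all add: \<pi>_def de)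
  have om_pi: "\<omega> x (\<pi> v) = \<omega> x v" "\<omega> (\<pi> v) x = \<omega> v x" if "x \<in> A" for x v
    using Ae[OF that] by (simp_all add: \<pi>_def om_simps)
  have nondeg: "x = 0" if x: "x \<in> A" "\<And>y. y \<in> A \<Longrightarrow> \<omega> x y = 0" for x
    using om_nondegenerate[of x] x AL om_pi(1)[OF x(1)] pi_A by (metis subsetD)
  have ideal: "lie_ideal L br (span {e})"
    by (rule lie_ideal_span) (use e(1) br_e in \<open>auto simp: span_base span_scale\<close>)
  have perp: "symp_perp L \<omega> (span {e}) = {x \<in> L. \<omega> x e = 0}" by (simp add: symp_perp_span)
  define br\<^sub>A where "br\<^sub>A x y = \<pi> (br x y)" for x y
  have A_perp: "A \<subseteq> symp_perp L \<omega> (span {e})" by (auto simp: perp A_def)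
  have pi_diff: "v - \<pi> v \<in> span {e}" if "v \<in> symp_perp L \<omega> (span {e})" for v
    using that by (simp add: perp \<pi>_def span_base span_scale)
  have pi_J: "\<pi> j = 0" if "j \<in> span {e}" for j
    using linear_eq_0_on_span[OF pi_lin _ that] pi_e by simp
  have pi_perp: "\<pi> v \<in> A" if "v \<in> symp_perp L \<omega> (span {e})" for v
    using that pi_A by (simp add: symp_perp_def)
  note red = reduction_symplectic[OF ideal A A_perp nondeg pi_lin pi_perp pi_diff pi_J pi_id]
    reduction_solvable[OF ideal A A_perp nondeg pi_lin pi_perp pi_diff pi_J pi_id solv]
  have sympA: "symplectic_lie_algebra_on A br\<^sub>A \<omega>" and solvA: "solvable_lie A br\<^sub>A"
    using red by (simp_all add: br\<^sub>A_def[abs_def])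
  note rep = represent_functional[OF bilinear_om A finitely_spanned_mono[OF finitely_spanned_L AL]
      nondeg]
  have "linear \<alpha>" by (simp add: \<alpha>_def linear_iff br_simps om_simps)
  then obtain p where p: "p \<in> A" "\<And>x. x \<in> A \<Longrightarrow> \<omega> p x = \<alpha> x" using rep by blast
  have "linear (\<lambda>x. \<omega> d (br d x))" by (simp add: linear_iff br_simps om_simps)
  then obtain q where q: "q \<in> A" "\<And>x. x \<in> A \<Longrightarrow> \<omega> q x = \<omega> d (br d x)" using rep by blast
  define D where "D x = \<pi> (br d x)" for x
  define \<epsilon> where "\<epsilon> = - \<alpha> d"
  define f where "f v = (\<omega> v e, \<pi> v, \<omega> d v)" for v
  have f_lin: "linear f"
    by (simp add: linear_iff f_def om_simps linear_add[OF pi_lin] linear_scale[OF pi_lin])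
  have ede: "br e d = \<epsilon> *\<^sub>R e"
    using br_skew[of e d] br_e[OF dL] by (simp add: \<epsilon>_def)
  have f_br_de: "f (br e d) = (0, 0, \<epsilon>)" "f (br d e) = (0, 0, - \<epsilon>)"
    using br_e[OF dL] by (simp_all add: ede f_def om_simps linear_scale[OF pi_lin] linear_neg[OF pi_lin] pi_e de \<epsilon>_def)
  have f_br_xe: "f (br x e) = (0, 0, \<omega> p x)" "f (br e x) = (0, 0, - \<omega> p x)" if x: "x \<in> A" for x
  proof -
    have *: "br x e = \<omega> p x *\<^sub>R e" using br_e[of x] x AL p(2) by auto
    show "f (br x e) = (0, 0, \<omega> p x)"
      by (simp add: * f_def om_simps linear_scale[OF pi_lin] pi_e de)
    then show "f (br e x) = (0, 0, - \<omega> p x)"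
      using br_skew[of x e] linear_neg[OF f_lin, of "br x e"] by simp
  qed
  have f_br_dx: "f (br d x) = (\<omega> p x, D x, \<omega> q x)" "f (br x d) = - (\<omega> p x, D x, \<omega> q x)"
    if x: "x \<in> A" for x
  proof -
    have "\<omega> (br x e) d = - \<omega> p x"
      using br_e[of x] x AL p(2) by (auto simp: om_simps ed)
    moreover have "\<omega> (br e d) x = 0" by (simp add: ede om_simps Ae[OF x])
    ultimately have "\<omega> (br d x) e = \<omega> p x" using om_closed[of d x e] by simp
    then show "f (br d x) = (\<omega> p x, D x, \<omega> q x)" by (simp add: f_def D_def q(2)[OF x])
    then show "f (br x d) = - (\<omega> p x, D x, \<omega> q x)"
      using br_skew[of d x] linear_neg[OF f_lin, of "br d x"] by simp
  qed
  have f_br_xy: "f (br x y) = (0, br\<^sub>A x y, \<omega> (D x) y + \<omega> x (D y))"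
    if x: "x \<in> A" and y: "y \<in> A" for x y
  proof -
    have "br x y \<in> symp_perp L \<omega> (span {e})"
      using symp_perp_closed[OF ideal] A_perp x y by blast
    moreover have "\<omega> d (br x y) = \<omega> (D x) y + \<omega> x (D y)"
      using om_closed[of x y d] om_skew[of d "br x y"] om_skew[of x "br d y"] br_skew[of d y]
      by (simp add: D_def om_pi x y om_simps)
    ultimately show ?thesis by (simp add: f_def perp br\<^sub>A_def)
  qed
  have decomp: "v = \<omega> v e *\<^sub>R d + \<pi> v + \<omega> d v *\<^sub>R e" for v by (simp add: \<pi>_def)
  have hom: "f (br v w) = line_bracket br\<^sub>A \<omega> p q D \<epsilon> (f v) (f w)" if vw: "v \<in> L" "w \<in> L" for v w
  proof -
    have "f (br (s *\<^sub>R d + x + t *\<^sub>R e) (s' *\<^sub>R d + x' + t' *\<^sub>R e))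
        = line_bracket br\<^sub>A \<omega> p q D \<epsilon> (s, x, t) (s', x', t')"
      if x: "x \<in> A" "x' \<in> A" for s s' t t' x x'
      by (simp add: br_simps linear_add[OF f_lin] linear_scale[OF f_lin] x f_br_de f_br_xe f_br_dx
          f_br_xy line_bracket_def Let_def linear_0[OF f_lin])
        (simp add: algebra_simps)
    from this[of "\<pi> v" "\<pi> w" "\<omega> v e" "\<omega> d v" "\<omega> w e" "\<omega> d w"] show ?thesis
      using decomp[of v] decomp[of w] pi_A vw by (simp add: f_def)
  qed
  have form: "line_form \<omega> (f v) (f w) = \<omega> v w" for v w
    by (simp add: line_form_def f_def \<pi>_def om_simps de ed om_skew[of w e] om_skew[of v d]
        algebra_simps)
  have f_between: "linear_between L (line_carrier A) f"
    by (rule linear_between_if_linear[OF f_lin]) (simp add: f_def line_carrier_def pi_A)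
  have bij: "bij_betw f L (line_carrier A)"
  proof (rule bij_betw_byWitness[where f' = "\<lambda>(s, x, t). s *\<^sub>R d + x + t *\<^sub>R e"])
    show "\<forall>v\<in>L. (case f v of (s, x, t) \<Rightarrow> s *\<^sub>R d + x + t *\<^sub>R e) = v"
      using decomp by (simp add: f_def)
    show "\<forall>u\<in>line_carrier A. f (case u of (s, x, t) \<Rightarrow> s *\<^sub>R d + x + t *\<^sub>R e) = u"
      by (auto simp: line_carrier_def f_def om_simps linear_add[OF pi_lin] linear_scale[OF pi_lin]
          pi_e pi_d pi_id Ae de ed)
    show "f ` L \<subseteq> line_carrier A" using f_between by (auto simp: linear_between_def)
    show "(\<lambda>(s, x, t). s *\<^sub>R d + x + t *\<^sub>R e) ` line_carrier A \<subseteq> L"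
      using AL dL e(1) subspace_L
      by (auto simp: line_carrier_def intro!: subspace_add subspace_scale)
  qed
  have "linear_between A A D"
    using pi_A br_mem
    by (intro linear_between_if_linear)
      (auto simp: D_def linear_iff br_simps linear_add[OF pi_lin] linear_scale[OF pi_lin])
  moreover have "symplectic_lie_algebra_on (line_carrier A)
      (line_bracket br\<^sub>A \<omega> p q D \<epsilon>) (line_form \<omega>)"
    by (rule symplectic_lie_algebra_on_transport[OF symplectic_lie_algebra_on_L f_between bij])
      (erule (1) hom, rule form)
  moreover have "symplectic_lie_isomorphic L br \<omega>
      (line_carrier A) (line_bracket br\<^sub>A \<omega> p q D \<epsilon>) (line_form \<omega>)"
    by (rule symplectic_lie_isomorphicI[OF f_between bij]) (erule (1) hom, rule form)
  ultimately have "double_extension_by_line L br \<omega> A br\<^sub>A \<omega>"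
    unfolding double_extension_by_line_def
    by (intro conjI bexI[OF _ p(1)] bexI[OF _ q(1)] exI[of _ D] exI[of _ \<epsilon>] sympA)
  then show ?thesis using sympA solvA by blast
qed

text \<open>
  The same scheme as for a line. That every \<open>x\<close> acts on the plane as the complex number
  \<open>\<alpha>(x) + i \<beta>(x)\<close> is exactly the shape required of the brackets with \<open>e\<^sub>0\<close> and \<open>e\<^sub>1\<close>; here \<open>a\<^sub>0\<close>
  represents \<open>\<alpha>\<close> and \<open>a\<^sub>1\<close> represents \<open>- \<beta>\<close>. The plane is abelian because \<open>[e\<^sub>0, e\<^sub>0] = 0\<close> makes the
  complex number by which \<open>e\<^sub>0\<close> acts vanish.
\<close>

theorem plane_extension:
  assumes solv: "solvable_lie L br"
    and e: "e0 \<in> L" "e1 \<in> L" "\<And>s t. s *\<^sub>R e0 + t *\<^sub>R e1 = 0 \<Longrightarrow> s = 0 \<and> t = 0"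
    and iso: "\<omega> e0 e1 = 0"
    and rot: "\<And>x. x \<in> L \<Longrightarrow>
      \<exists>\<alpha> \<beta>. br x e0 = \<alpha> *\<^sub>R e0 + \<beta> *\<^sub>R e1 \<and> br x e1 = - \<beta> *\<^sub>R e0 + \<alpha> *\<^sub>R e1"
  shows "\<exists>(A :: 'g set) br\<^sub>A \<omega>\<^sub>A. symplectic_lie_algebra_on A br\<^sub>A \<omega>\<^sub>A \<and> solvable_lie A br\<^sub>A \<and>
      double_extension_by_plane L br \<omega> A br\<^sub>A \<omega>\<^sub>A"
proof -
  have iso': "\<omega> e1 e0 = 0" using iso om_zero_commute by simp
  have dual: "\<exists>d\<in>L. \<omega> d e0 = a \<and> \<omega> d e1 = b" for a b
  proof -
    have ne: "e0 \<noteq> e1" using e(3)[of 1 "- 1"] by auto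
    have "e1 \<noteq> 0" using e(3)[of 0 1] by auto
    moreover have "e0 \<notin> span {e1}"
    proof
      assume "e0 \<in> span {e1}"
      then obtain k where "e0 = k *\<^sub>R e1" by (auto simp: span_singleton)
      then show False using e(3)[of 1 "- k"] by simp
    qed
    ultimately have "independent {e0, e1}"
      by (simp add: independent_insert)
    then obtain g where g: "linear g" "\<forall>x\<in>{e0, e1}. g x = (if x = e0 then a else b)"
      using linear_independent_extend[of "{e0, e1}" "\<lambda>x. if x = e0 then a else b"] by blast
    have "\<exists>d\<in>L. \<forall>x\<in>L. \<omega> d x = g x"
      by (rule represent_functional[OF bilinear_om subspace_L finitely_spanned_L
            om_nondegenerate g(1)])
    then obtain d where d: "d \<in> L" "\<forall>x\<in>L. \<omega> d x = g x" by blast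
    have "\<omega> d e0 = a" "\<omega> d e1 = b" using d(2) g(2) e(1,2) ne by simp_all
    then show ?thesis using d(1) by blast
  qed
  obtain d1 where d1: "d1 \<in> L" "\<omega> d1 e0 = 0" "\<omega> d1 e1 = 1" using dual by blast
  obtain d' where d': "d' \<in> L" "\<omega> d' e0 = 1" "\<omega> d' e1 = 0" using dual by blast
  \<comment> \<open>The multiple of \<open>e1\<close> makes \<open>d0\<close> orthogonal to \<open>d1\<close> and keeps its values on the plane.\<close>
  define d0 where "d0 = d' + \<omega> d' d1 *\<^sub>R e1"
  have ed1: "\<omega> e0 d1 = 0" "\<omega> e1 d1 = - 1"
    using om_skew[of e0 d1] om_skew[of e1 d1] d1 by auto
  have d0: "d0 \<in> L" "\<omega> d0 e0 = 1" "\<omega> d0 e1 = 0" "\<omega> d0 d1 = 0"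
    using d' e subspace_L iso'
    by (auto simp: d0_def om_simps ed1 subspace_add subspace_scale)
  have ed0: "\<omega> e0 d0 = - 1" "\<omega> e1 d0 = 0" "\<omega> d1 d0 = 0"
    using om_skew[of e0 d0] om_skew[of e1 d0] om_skew[of d1 d0] d0 by auto
  note dual_simps = d0(2-4) d1(2,3) ed0 ed1 iso iso'
  define \<alpha> where "\<alpha> x = \<omega> d0 (br x e0)" for x
  define \<beta> where "\<beta> x = \<omega> d1 (br x e0)" for x
  have br_e: "br x e0 = \<alpha> x *\<^sub>R e0 + \<beta> x *\<^sub>R e1" "br x e1 = - \<beta> x *\<^sub>R e0 + \<alpha> x *\<^sub>R e1"
    if x: "x \<in> L" for x
  proof -
    obtain a b where "br x e0 = a *\<^sub>R e0 + b *\<^sub>R e1" "br x e1 = - b *\<^sub>R e0 + a *\<^sub>R e1"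
      using rot[OF x] by blast
    then show "br x e0 = \<alpha> x *\<^sub>R e0 + \<beta> x *\<^sub>R e1" "br x e1 = - \<beta> x *\<^sub>R e0 + \<alpha> x *\<^sub>R e1"
      by (simp_all add: \<alpha>_def \<beta>_def om_simps dual_simps)
  qed
  have e_comm: "br e0 e1 = 0" "br e1 e0 = 0"
  proof -
    have "\<alpha> e0 = 0 \<and> \<beta> e0 = 0"
      using e(3)[of "\<alpha> e0" "\<beta> e0"] br_e(1)[OF e(1)] by simp
    then show "br e0 e1 = 0" using br_e(2)[OF e(1)] by simp
    then show "br e1 e0 = 0" using br_skew[of e0 e1] by simp
  qed
  define \<pi> where "\<pi> v = v - \<omega> v e0 *\<^sub>R d0 - \<omega> v e1 *\<^sub>R d1 - \<omega> d0 v *\<^sub>R e0 - \<omega> d1 v *\<^sub>R e1" for v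
  define A where "A = {x \<in> L. \<omega> x e0 = 0 \<and> \<omega> x e1 = 0 \<and> \<omega> d0 x = 0 \<and> \<omega> d1 x = 0}"
  have AL: "A \<subseteq> L" by (auto simp: A_def)
  have A: "subspace A"
    using subspace_L by (auto simp: A_def subspace_def om_simps)
  have Ae: "\<omega> x e0 = 0" "\<omega> e0 x = 0" "\<omega> x e1 = 0" "\<omega> e1 x = 0"
    "\<omega> d0 x = 0" "\<omega> x d0 = 0" "\<omega> d1 x = 0" "\<omega> x d1 = 0" if "x \<in> A" for x
    using that om_zero_commute by (auto simp: A_def)
  have pi_lin: "linear \<pi>"
    by (simp add: linear_iff \<pi>_def om_simps algebra_simps)
  have pi_A: "\<pi> v \<in> A" if "v \<in> L" for v
    using that d0(1) d1(1) e(1,2) subspace_L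
    by (simp add: A_def \<pi>_def om_simps dual_simps subspace_diff subspace_scale)
  have pi_id: "\<pi> x = x" if "x \<in> A" for x using Ae[OF that] by (simp add: \<pi>_def)
  have pi_ed: "\<pi> e0 = 0" "\<pi> e1 = 0" "\<pi> d0 = 0" "\<pi> d1 = 0"
    by (simp_all add: \<pi>_def dual_simps)
  have om_pi: "\<omega> x (\<pi> v) = \<omega> x v" "\<omega> (\<pi> v) x = \<omega> v x" if "x \<in> A" for x v
    using Ae[OF that] by (simp_all add: \<pi>_def om_simps)
  have nondeg: "x = 0" if x: "x \<in> A" "\<And>y. y \<in> A \<Longrightarrow> \<omega> x y = 0" for x
    using om_nondegenerate[of x] x AL om_pi(1)[OF x(1)] pi_A by (metis subsetD)
  define J where "J = span {e0, e1}"
  have J_mem: "s *\<^sub>R e0 + t *\<^sub>R e1 \<in> J" for s t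
    unfolding J_def by (intro span_add span_scale span_base) auto
  have ideal: "lie_ideal L br J"
    unfolding J_def
  proof (rule lie_ideal_span)
    show "{e0, e1} \<subseteq> L" using e(1,2) by simp
    fix x v assume x: "x \<in> L" and v: "v \<in> {e0, e1}"
    have "br x e0 \<in> J" "br x e1 \<in> J" unfolding br_e[OF x] by (rule J_mem)+
    then show "br x v \<in> span {e0, e1}" using v by (auto simp: J_def)
  qed
  have perp: "symp_perp L \<omega> J = {x \<in> L. \<omega> x e0 = 0 \<and> \<omega> x e1 = 0}"
    by (simp add: symp_perp_span J_def)
  define br\<^sub>A where "br\<^sub>A x y = \<pi> (br x y)" for x y
  have A_perp: "A \<subseteq> symp_perp L \<omega> J" by (auto simp: perp A_def)
  have pi_diff: "v - \<pi> v \<in> J" if "v \<in> symp_perp L \<omega> J" for v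
    using that J_mem[of "\<omega> d0 v" "\<omega> d1 v"] by (simp add: perp \<pi>_def add.commute)
  have pi_J: "\<pi> j = 0" if "j \<in> J" for j
    using linear_eq_0_on_span[OF pi_lin, of "{e0, e1}" j] that pi_ed by (auto simp: J_def)
  have pi_perp: "\<pi> v \<in> A" if "v \<in> symp_perp L \<omega> J" for v
    using that pi_A by (simp add: symp_perp_def)
  note red = reduction_symplectic[OF ideal A A_perp nondeg pi_lin pi_perp pi_diff pi_J pi_id]
    reduction_solvable[OF ideal A A_perp nondeg pi_lin pi_perp pi_diff pi_J pi_id solv]
  have sympA: "symplectic_lie_algebra_on A br\<^sub>A \<omega>" and solvA: "solvable_lie A br\<^sub>A"
    using red by (simp_all add: br\<^sub>A_def[abs_def])
  have rep: "\<exists>p\<in>A. \<forall>x\<in>A. \<omega> p x = g x" if "linear g" for g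
    by (rule represent_functional[OF bilinear_om A finitely_spanned_mono[OF finitely_spanned_L AL]
          nondeg that])
  have "linear \<alpha>" "linear (\<lambda>x. - \<beta> x)"
    by (simp_all add: \<alpha>_def \<beta>_def linear_iff br_simps om_simps)
  then obtain a0 a1 where a0: "a0 \<in> A" "\<And>x. x \<in> A \<Longrightarrow> \<omega> a0 x = \<alpha> x"
    and a1: "a1 \<in> A" "\<And>x. x \<in> A \<Longrightarrow> \<omega> a1 x = - \<beta> x"
    using rep[of \<alpha>] rep[of "\<lambda>x. - \<beta> x"] by blast
  have "linear (\<lambda>x. \<omega> d (br d' x))" for d d' by (simp add: linear_iff br_simps om_simps)
  note rep' = rep[OF this]
  obtain b0 where b0: "b0 \<in> A" "\<And>x. x \<in> A \<Longrightarrow> \<omega> b0 x = \<omega> d0 (br d0 x)" using rep' by blast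
  obtain b1 where b1: "b1 \<in> A" "\<And>x. x \<in> A \<Longrightarrow> \<omega> b1 x = \<omega> d1 (br d0 x)" using rep' by blast
  obtain b2 where b2: "b2 \<in> A" "\<And>x. x \<in> A \<Longrightarrow> \<omega> b2 x = \<omega> d1 (br d1 x)" using rep' by blast
  define D0 where "D0 x = \<pi> (br d0 x)" for x
  define D1 where "D1 x = \<pi> (br d1 x)" for x
  define z where "z = \<pi> (br d0 d1)"
  have zA: "z \<in> A" unfolding z_def by (rule pi_A) (rule br_mem)
  define \<epsilon>0 where "\<epsilon>0 = \<alpha> d0"
  define \<epsilon>1 where "\<epsilon>1 = \<beta> d0"
  define \<epsilon>2 where "\<epsilon>2 = \<alpha> d1"
  define \<epsilon>3 where "\<epsilon>3 = \<beta> d1"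
  define \<epsilon>4 where "\<epsilon>4 = \<omega> d0 (br d0 d1)"
  define \<epsilon>5 where "\<epsilon>5 = \<omega> d1 (br d0 d1)"
  define f where "f v = (\<omega> v e0, \<omega> v e1, \<pi> v, \<omega> d0 v, \<omega> d1 v)" for v
  have f_lin: "linear f"
    by (simp add: linear_iff f_def om_simps linear_add[OF pi_lin] linear_scale[OF pi_lin])
  note f_simps = linear_add[OF f_lin] linear_scale[OF f_lin] linear_0[OF f_lin]
  have f_skew: "f (br x y) = - f (br y x)" for x y
    using br_skew[of x y] linear_neg[OF f_lin, of "br y x"] by simp
  have f_e: "f (s *\<^sub>R e0 + t *\<^sub>R e1) = (0, 0, 0, s, t)" for s t
    by (simp add: f_def om_simps dual_simps linear_add[OF pi_lin] linear_scale[OF pi_lin] pi_ed)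
  have f_br_de: "f (br d0 e0) = (0, 0, 0, \<epsilon>0, \<epsilon>1)" "f (br d0 e1) = (0, 0, 0, - \<epsilon>1, \<epsilon>0)"
    "f (br d1 e0) = (0, 0, 0, \<epsilon>2, \<epsilon>3)" "f (br d1 e1) = (0, 0, 0, - \<epsilon>3, \<epsilon>2)"
    by (simp_all only: br_e[OF d0(1)] br_e[OF d1(1)] f_e \<epsilon>0_def \<epsilon>1_def \<epsilon>2_def \<epsilon>3_def)
  have f_br_xe: "f (br x e0) = (0, 0, 0, \<omega> a0 x, - \<omega> a1 x)"
    "f (br x e1) = (0, 0, 0, \<omega> a1 x, \<omega> a0 x)" if x: "x \<in> A" for x
  proof -
    have "x \<in> L" using x AL by blast
    then show "f (br x e0) = (0, 0, 0, \<omega> a0 x, - \<omega> a1 x)"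
      "f (br x e1) = (0, 0, 0, \<omega> a1 x, \<omega> a0 x)"
      by (simp_all only: br_e f_e a0(2)[OF x] a1(2)[OF x] minus_minus)
  qed
  have om_br_e: "\<omega> d (br c e0) = \<alpha> c * \<omega> d e0 + \<beta> c * \<omega> d e1"
    "\<omega> d (br c e1) = \<alpha> c * \<omega> d e1 - \<beta> c * \<omega> d e0" if "c \<in> L" for c d
    using br_e[OF that] by (simp_all add: om_simps)
  \<comment> \<open>Closedness of the form, solved for one component of a bracket.\<close>
  have closed: "\<omega> (br c y) u = \<omega> c (br y u) - \<omega> y (br c u)" for c y u
    using om_closed[of c y u] om_skew[of c "br y u"] om_skew[of y "br c u"] br_skew[of c u]
    by (simp add: om_simps)
  have f_br_dd: "f (br d0 d1) = (\<epsilon>2 - \<epsilon>1, - (\<epsilon>0 + \<epsilon>3), z, \<epsilon>4, \<epsilon>5)"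
    by (simp add: f_def closed om_br_e d0(1) d1(1) dual_simps z_def
        \<epsilon>0_def \<epsilon>1_def \<epsilon>2_def \<epsilon>3_def \<epsilon>4_def \<epsilon>5_def)
  have f_br_dx: "f (br d0 x) = (\<omega> a0 x, \<omega> a1 x, D0 x, \<omega> b0 x, \<omega> b1 x)"
    "f (br d1 x) = (- \<omega> a1 x, \<omega> a0 x, D1 x, \<omega> (b1 + z) x, \<omega> b2 x)" if x: "x \<in> A" for x
  proof -
    have xL: "x \<in> L" using x AL by blast
    show "f (br d0 x) = (\<omega> a0 x, \<omega> a1 x, D0 x, \<omega> b0 x, \<omega> b1 x)"
      by (simp add: f_def D0_def a0(2)[OF x] a1(2)[OF x] b0(2)[OF x] b1(2)[OF x]
          closed om_br_e d0(1) xL dual_simps Ae[OF x])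
    \<comment> \<open>Closedness on \<open>(d0, d1, x)\<close> is the reason for \<open>b\<^sub>1 + z\<close> in the definition of the extension.\<close>
    have "\<omega> d0 (br d1 x) = \<omega> (b1 + z) x"
      using closed[of d0 d1 x] by (simp add: om_simps z_def om_pi[OF x] b1(2)[OF x])
    then show "f (br d1 x) = (- \<omega> a1 x, \<omega> a0 x, D1 x, \<omega> (b1 + z) x, \<omega> b2 x)"
      by (simp add: f_def D1_def a0(2)[OF x] a1(2)[OF x] b2(2)[OF x]
          closed om_br_e d1(1) xL dual_simps Ae[OF x])
  qed
  have f_br_xy: "f (br x y) = (0, 0, br\<^sub>A x y, \<omega> (D0 x) y + \<omega> x (D0 y), \<omega> (D1 x) y + \<omega> x (D1 y))"
    if x: "x \<in> A" and y: "y \<in> A" for x y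
  proof -
    have "br x y \<in> symp_perp L \<omega> J"
      using symp_perp_closed[OF ideal] A_perp x y by blast
    moreover have "\<omega> d (br x y) = \<omega> (\<pi> (br d x)) y + \<omega> x (\<pi> (br d y))" for d
      using closed[of d x y] by (simp add: om_pi x y)
    ultimately show ?thesis by (simp add: f_def perp br\<^sub>A_def D0_def D1_def)
  qed
  define g where "g = (\<lambda>(s0, s1, x, t0, t1).
    s0 *\<^sub>R d0 + s1 *\<^sub>R d1 + x + t0 *\<^sub>R e0 + t1 *\<^sub>R e1)"
  have gf: "g (f v) = v" for v by (simp add: \<pi>_def g_def f_def)
  have fg: "f (g u) = u" if "u \<in> plane_carrier A" for u
    using that by (auto simp: plane_carrier_def f_def g_def om_simps linear_add[OF pi_lin]
        linear_scale[OF pi_lin] pi_ed pi_id Ae dual_simps)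
  let ?br = "plane_bracket br\<^sub>A \<omega> a0 a1 b0 b1 b2 z D0 D1 \<epsilon>0 \<epsilon>1 \<epsilon>2 \<epsilon>3 \<epsilon>4 \<epsilon>5"
  have f_mem: "f v \<in> plane_carrier A" if "v \<in> L" for v
    using that by (simp add: f_def plane_carrier_def pi_A)
  have hom: "f (br v w) = ?br (f v) (f w)" if vw: "v \<in> L" "w \<in> L" for v w
  proof -
    have "f (br (g (s0, s1, x, t0, t1)) (g (s0', s1', x', t0', t1')))
        = ?br (s0, s1, x, t0, t1) (s0', s1', x', t0', t1')"
      if x: "x \<in> A" "x' \<in> A" for s0 s1 s0' s1' t0 t1 t0' t1' x x'
      by (simp add: g_def br_simps f_simps x f_skew[of e0 d0] f_skew[of e1 d0] f_skew[of e0 d1]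
          f_skew[of e1 d1] f_skew[of d1 d0] f_skew[of x d0] f_skew[of x d1] f_skew[of e0 x']
          f_skew[of e1 x'] e_comm f_br_de f_br_xe f_br_dd f_br_dx f_br_xy plane_bracket_def Let_def)
        (simp add: algebra_simps)
    then have "f (br (g u) (g u')) = ?br u u'" if "u \<in> plane_carrier A" "u' \<in> plane_carrier A" for u u'
      using that by (auto simp: plane_carrier_def)
    from this[OF f_mem[OF vw(1)] f_mem[OF vw(2)]] show ?thesis by (simp add: gf)
  qed
  have form: "plane_form \<omega> (f v) (f w) = \<omega> v w" for v w
    by (simp add: plane_form_def f_def \<pi>_def om_simps dual_simps om_skew[of w e0] om_skew[of w e1]
        om_skew[of v d0] om_skew[of v d1] algebra_simps)
  have f_between: "linear_between L (plane_carrier A) f"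
    by (rule linear_between_if_linear[OF f_lin f_mem])
  have bij: "bij_betw f L (plane_carrier A)"
  proof (rule bij_betw_byWitness[where f' = g])
    show "\<forall>v\<in>L. g (f v) = v" by (simp add: gf)
    show "\<forall>u\<in>plane_carrier A. f (g u) = u" using fg by blast
    show "f ` L \<subseteq> plane_carrier A" using f_mem by blast
    show "g ` plane_carrier A \<subseteq> L"
      using AL d0(1) d1(1) e(1,2) subspace_L
      by (auto simp: plane_carrier_def g_def intro!: subspace_add subspace_scale)
  qed
  have D: "linear_between A A D0" "linear_between A A D1"
    using pi_A br_mem
    by (intro linear_between_if_linear;
        auto simp: D0_def D1_def linear_iff br_simps linear_add[OF pi_lin] linear_scale[OF pi_lin])+
  have ext: "symplectic_lie_algebra_on (plane_carrier A) ?br (plane_form \<omega>)"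
    by (rule symplectic_lie_algebra_on_transport[OF symplectic_lie_algebra_on_L f_between bij])
      (erule (1) hom, rule form)
  have "symplectic_lie_isomorphic L br \<omega> (plane_carrier A) ?br (plane_form \<omega>)"
    by (rule symplectic_lie_isomorphicI[OF f_between bij]) (erule (1) hom, rule form)
  with sympA D ext have "double_extension_by_plane L br \<omega> A br\<^sub>A \<omega>"
    unfolding double_extension_by_plane_def
    by - (rule conjI, assumption, rule bexI[OF _ a0(1)], rule bexI[OF _ a1(1)],
        rule bexI[OF _ b0(1)], rule bexI[OF _ b1(1)], rule bexI[OF _ b2(1)], rule bexI[OF _ zA],
        rule exI[of _ D0], rule exI[of _ D1], rule exI[of _ \<epsilon>0], rule exI[of _ \<epsilon>1],
        rule exI[of _ \<epsilon>2], rule exI[of _ \<epsilon>3], rule exI[of _ \<epsilon>4], rule exI[of _ \<epsilon>5],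
        intro conjI)
  then show ?thesis using sympA solvA by blast
qed

end

section \<open>Solvable symplectic Lie algebras with an isotropic ideal\<close>

lemma symplectic_lie_isomorphic_cong:
  assumes "\<And>x y. x \<in> L \<Longrightarrow> y \<in> L \<Longrightarrow> br' x y = br x y"
    and "\<And>x y. x \<in> L \<Longrightarrow> y \<in> L \<Longrightarrow> \<omega>' x y = \<omega> x y"
  shows "symplectic_lie_isomorphic L br' \<omega>' = symplectic_lie_isomorphic L br \<omega>"
  unfolding symplectic_lie_isomorphic_def fun_eq_iff using assms by simp

theorem theorem5p1:
  fixes L :: "'g::real_vector set"
    and br :: "'g \<Rightarrow> 'g \<Rightarrow> 'g"
    and \<omega> :: "'g \<Rightarrow> 'g \<Rightarrow> real"
  assumes "symplectic_lie_algebra_on L br \<omega>"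
    and "solvable_lie L br"
    and "\<exists>I. lie_ideal L br I \<and> isotropic L \<omega> I \<and> I \<noteq> {0}"
  shows "\<exists>(A :: 'g set) br\<^sub>A \<omega>\<^sub>A.
      symplectic_lie_algebra_on A br\<^sub>A \<omega>\<^sub>A \<and> solvable_lie A br\<^sub>A \<and>
      (double_extension_by_line L br \<omega> A br\<^sub>A \<omega>\<^sub>A \<or>
       double_extension_by_plane L br \<omega> A br\<^sub>A \<omega>\<^sub>A)"
proof -
  interpret S: symplectic_lie_algebra_on L br \<omega> by (rule assms(1))
  have L: "subspace L" "finitely_spanned L"
    using S.subspace_carrier S.finite_dim_carrier by (auto simp: finitely_spanned_def)
  have br_L: "br x y \<in> L" if "x \<in> L" "y \<in> L" for x y
    using S.bilinear_bracket that by (simp add: bilinear_between_def linear_between_def)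
  obtain P where P: "linear P" "\<And>x. P x \<in> L" "\<And>x. x \<in> L \<Longrightarrow> P x = x"
    using projection_onto_subspace[OF L] by blast
  define br' where "br' x y = br (P x) (P y)" for x y
  define \<omega>' where "\<omega>' x y = \<omega> (P x) (P y)" for x y
  have br': "br' x y = br x y" and om': "\<omega>' x y = \<omega> x y" if "x \<in> L" "y \<in> L" for x y
    using that P(3) by (simp_all add: br'_def \<omega>'_def)
  interpret T: total_symplectic_lie_algebra L br' \<omega>'
    unfolding br'_def[abs_def] \<omega>'_def[abs_def]
    by (rule total_symplectic_lie_algebra_projection[OF assms(1) P])
  have iso: "symplectic_lie_isomorphic L br' \<omega>' = symplectic_lie_isomorphic L br \<omega>"
    by (rule symplectic_lie_isomorphic_cong) (erule (1) br', erule (1) om')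
  have ext_eq: "double_extension_by_line L br' \<omega>' = double_extension_by_line L br \<omega>"
    "double_extension_by_plane L br' \<omega>' = double_extension_by_plane L br \<omega>"
    unfolding fun_eq_iff double_extension_by_line_def double_extension_by_plane_def iso
    by (intro allI refl)+
  have "solvable_lie L br' \<longleftrightarrow> solvable_lie L br"
    by (rule solvable_lie_cong[OF _ L(1)]) (erule (1) br', erule (1) br_L)
  with assms(2) have solv: "solvable_lie L br'" by simp
  obtain I where I: "lie_ideal L br I" "isotropic L \<omega> I" "I \<noteq> {0}" using assms(3) by blast
  have IL: "I \<subseteq> L" using I(1) by (simp add: lie_ideal_def)
  have I': "lie_ideal L br' I" using I(1) IL by (auto simp: lie_ideal_def br')
  show ?thesis
  proof (rule T.ideal_contains_line_or_complex_plane[OF solv I' I(3)])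
    fix e assume e: "e \<in> I" "e \<noteq> 0" "\<And>x. x \<in> L \<Longrightarrow> \<exists>\<alpha>. br' x e = \<alpha> *\<^sub>R e"
    have "e \<in> L" using e(1) IL by blast
    from T.line_extension[OF solv this e(2,3)] show ?thesis unfolding ext_eq by blast
  next
    fix e0 e1 assume e: "e0 \<in> I" "e1 \<in> I"
      "\<And>s t. s *\<^sub>R e0 + t *\<^sub>R e1 = 0 \<Longrightarrow> s = 0 \<and> t = 0"
      "\<And>x. x \<in> L \<Longrightarrow>
        \<exists>\<alpha> \<beta>. br' x e0 = \<alpha> *\<^sub>R e0 + \<beta> *\<^sub>R e1 \<and> br' x e1 = - \<beta> *\<^sub>R e0 + \<alpha> *\<^sub>R e1"
    have "e0 \<in> L" "e1 \<in> L" using e(1,2) IL by auto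
    moreover have "\<omega>' e0 e1 = 0"
      using I(2) e(1,2) IL by (auto simp: isotropic_def symp_perp_def om' subset_iff)
    ultimately show ?thesis
      using T.plane_extension[OF solv _ _ e(3) _ e(4)] unfolding ext_eq by blast
  qed
qed

end
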